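(* Let $n\geq 2$, $1<p<\infty$, and $\alpha\in\mathbb{R}$ with $\alpha+p>n$. Then for every domain $\Omega\subsetneqq\mathbb{R}^n$, $$\int_{\Omega}\frac{|\nabla\varphi|^p}{\mathrm{d}_\Omega^{\alpha}}\,\mathrm{d}x\;\geq\;\left(\frac{\alpha+p-n}{p}\right)^p\int_{\Omega}\frac{|\varphi|^p}{\mathrm{d}_\Omega^{p+\alpha}}\,\mathrm{d}x\qquad\text{for all }\varphi\in C_c^\infty(\Omega),$$ and the lower bound constant $\left(\frac{\alpha+p-n}{p}\right)^p$ is sharp, i.e. for no constant $c>\left(\frac{\alpha+p-n}{p}\right)^p$ does the inequality with $c$ in place of $\left(\frac{\alpha+p-n}{p}\right)^p$ hold for all domains $\Omega\subsetneqq\mathbb{R}^n$ and all $\varphi\in C_c^\infty(\Omega)$. In particular, if $p>n$, then $$H_p(\Omega)\geq\left(\frac{p-n}{p}\right)^p\qquad\text{for every domain }\Omega\subsetneqq\mathbb{R}^n.$$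
   Context: A domain is a nonempty connected open set. For a domain $\Omega\subsetneqq\mathbb{R}^n$ and $x\in\Omega$, $\mathrm{d}_\Omega(x)=\mathrm{dist}(x,\partial\Omega)$ denotes the Euclidean distance from $x$ to the boundary of $\Omega$. $H_p(\Omega)$ denotes the $L^p$-Hardy constant of $\Omega$, i.e. the best (largest) constant $c\geq 0$ such that $\int_\Omega|\nabla\varphi|^p\,\mathrm{d}x\geq c\int_\Omega\frac{|\varphi|^p}{\mathrm{d}_\Omega^p}\,\mathrm{d}x$ for all $\varphi\in C_c^\infty(\Omega)$. *)

theory Defs
  imports "HOL-Analysis.Analysis"
begin

definition is_domain :: "'a::euclidean_space set \<Rightarrow> bool" where
  "is_domain \<Omega> \<longleftrightarrow> open \<Omega> \<and> connected \<Omega> \<and> \<Omega> \<noteq> {}"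

definition bdist :: "'a::euclidean_space set \<Rightarrow> 'a \<Rightarrow> real" where
  "bdist \<Omega> x = infdist x (frontier \<Omega>)"

definition partial_deriv :: "'a::euclidean_space \<Rightarrow> ('a \<Rightarrow> real) \<Rightarrow> 'a \<Rightarrow> real" where
  "partial_deriv b f x = frechet_derivative f (at x) b"

definition gradient :: "('a::euclidean_space \<Rightarrow> real) \<Rightarrow> 'a \<Rightarrow> 'a" where
  "gradient f x = (\<Sum>b\<in>Basis. partial_deriv b f x *\<^sub>R b)"

primrec C_k :: "nat \<Rightarrow> ('a::euclidean_space \<Rightarrow> real) \<Rightarrow> bool" where
  "C_k 0 f \<longleftrightarrow> continuous_on UNIV f"
| "C_k (Suc k) f \<longleftrightarrow> f differentiable_on UNIV \<and> (\<forall>b\<in>Basis. C_k k (partial_deriv b f))"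

definition C_infinity :: "('a::euclidean_space \<Rightarrow> real) \<Rightarrow> bool" where
  "C_infinity f \<longleftrightarrow> (\<forall>k. C_k k f)"

text \<open>Test functions on \<open>\<Omega>\<close> are represented by their extensions by zero to the whole space.\<close>

definition test_functions :: "'a::euclidean_space set \<Rightarrow> ('a \<Rightarrow> real) set" where
  "test_functions \<Omega> =
     {\<phi>. C_infinity \<phi> \<and> compact (closure {x. \<phi> x \<noteq> 0}) \<and> closure {x. \<phi> x \<noteq> 0} \<subseteq> \<Omega>}"

text \<open>All integrands are nonnegative, so the integrals are taken in \<open>[0, \<infinity>]\<close>. The constant
  \<open>c\<close> is only ever nonnegative (\<^term>\<open>ennreal c = 0\<close> for negative \<open>c\<close>).\<close>

definition weighted_hardy_ineq :: "real \<Rightarrow> real \<Rightarrow> 'a::euclidean_space set \<Rightarrow> real \<Rightarrow> bool" where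
  "weighted_hardy_ineq p \<alpha> \<Omega> c \<longleftrightarrow>
     (\<forall>\<phi>\<in>test_functions \<Omega>.
        (\<integral>\<^sup>+x\<in>\<Omega>. ennreal (norm (gradient \<phi> x) powr p / bdist \<Omega> x powr \<alpha>) \<partial>lborel)
        \<ge> ennreal c * (\<integral>\<^sup>+x\<in>\<Omega>. ennreal (\<bar>\<phi> x\<bar> powr p / bdist \<Omega> x powr (p + \<alpha>)) \<partial>lborel))"

text \<open>For a proper domain the set below contains \<open>0\<close> and is bounded above, because \<open>\<Omega>\<close> carries
  a nonzero test function, so the supremum is a genuine one.\<close>

definition hardy_const :: "real \<Rightarrow> 'a::euclidean_space set \<Rightarrow> real" where
  "hardy_const p \<Omega> = Sup {c. c \<ge> 0 \<and>
     (\<forall>\<phi>\<in>test_functions \<Omega>.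
        (\<integral>\<^sup>+x\<in>\<Omega>. ennreal (norm (gradient \<phi> x) powr p) \<partial>lborel)
        \<ge> ennreal c * (\<integral>\<^sup>+x\<in>\<Omega>. ennreal (\<bar>\<phi> x\<bar> powr p / bdist \<Omega> x powr p) \<partial>lborel))}"

end

theory Submission
  imports Defs "HOL-Real_Asymp.Real_Asymp"
begin

text \<open>
  Put \<open>\<kappa> = (\<alpha> + p - n) / p\<close>. On a set \<open>C\<close> that is star-shaped about a point \<open>y\<close> with \<open>\<phi> y = 0\<close>,
  one has \<open>\<bar>\<phi> x\<bar> \<le> \<bar>x - y\<bar> \<integral>\<^sub>0\<^sup>1 \<bar>\<nabla>\<phi> (y + t (x - y))\<bar> dt\<close>. Jensen's inequality with weight
  \<open>\<kappa> t\<^bsup>\<kappa> - 1\<^esup>\<close>, Fubini and the dilation \<open>x \<mapsto> y + t (x - y)\<close> give the Hardy inequality on \<open>C\<close>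
  with constant \<open>\<kappa>\<^sup>p\<close> and the distance to \<open>y\<close> as weight. By compactness, finitely many
  boundary points approximate the distance to the boundary up to a factor \<open>1 + \<eta>\<close> on the
  support of \<open>\<phi>\<close>; their Voronoi cells are star-shaped, so summing over the cells and letting
  \<open>\<eta> \<rightarrow> 0\<close> yields the inequality for every domain.

  For sharpness take the punctured space and truncate \<open>\<bar>x\<bar>\<^sup>\<kappa>\<close> at \<open>\<bar>x\<bar>\<^sup>2 \<approx> 1\<close> and \<open>\<bar>x\<bar>\<^sup>2 \<approx> B\<close>.
  Both integrands equal \<open>\<bar>x\<bar>\<^bsup>-n\<^esup> dx\<close>, up to the factor \<open>\<kappa>\<^sup>p\<close>, in between. This measure is
  dilation invariant, so the contribution of the transition shells stays bounded while the bulk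
  grows without bound as \<open>B \<rightarrow> \<infinity>\<close>.
\<close>

subsection \<open>Smooth functions\<close>

text \<open>The flat function exp(-1/r), extended by 0, is the case k = 0. The factor r^(-k) makes
  the family closed under differentiation up to linear combinations.\<close>

definition flat_exp :: "nat \<Rightarrow> real \<Rightarrow> real" where
  "flat_exp k r = (if r > 0 then exp (- (1 / r)) / r ^ k else 0)"

lemma flat_exp_has_derivative:
  "(flat_exp k has_real_derivative flat_exp (k + 2) r - real k * flat_exp (k + 1) r) (at r)"
proof -
  consider "r > 0" | "r < 0" | "r = 0" by linarith
  then show ?thesis
  proof cases
    case 1
    have "((\<lambda>r. exp (- (1 / r)) / r ^ k) has_real_derivative
        flat_exp (k + 2) r - real k * flat_exp (k + 1) r) (at r)"
      by (rule derivative_eq_intros refl | use 1 in simp; fail)+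
        (use 1 in \<open>cases k; simp add: flat_exp_def field_simps power2_eq_square power_add\<close>)
    then show ?thesis
      by (rule has_field_derivative_transform_within_open[of _ _ _ "{0<..}"])
        (use 1 in \<open>auto simp: flat_exp_def\<close>)
  next
    case 2
    have "((\<lambda>r. 0) has_real_derivative flat_exp (k + 2) r - real k * flat_exp (k + 1) r) (at r)"
      using 2 by (auto simp: flat_exp_def)
    then show ?thesis
      by (rule has_field_derivative_transform_within_open[of _ _ _ "{..<0}"])
        (use 2 in \<open>auto simp: flat_exp_def\<close>)
  next
    case 3
    \<comment> \<open>This is the right difference quotient at 0, where
      \<open>flat_exp k 0 = 0\<close>; the exponential beats every power of y. The left quotient is
      0, and so is the claimed derivative.\<close>
    have "((\<lambda>y. exp (- (1 / y)) / y ^ Suc k) \<longlongrightarrow> 0) (at_right (0::real))"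
      by real_asymp
    moreover have "\<forall>\<^sub>F y in at_right 0. exp (- (1 / y)) / y ^ Suc k = flat_exp k y / y"
      by (auto simp: eventually_at_filter flat_exp_def)
    ultimately have "((\<lambda>y. flat_exp k y / y) \<longlongrightarrow> 0) (at_right 0)"
      by (rule Lim_transform_eventually)
    moreover have "((\<lambda>y. flat_exp k y / y) \<longlongrightarrow> 0) (at_left 0)"
      by (rule Lim_transform_eventually[OF tendsto_const])
        (auto simp: eventually_at_filter flat_exp_def)
    ultimately have "((\<lambda>y. flat_exp k y / y) \<longlongrightarrow> 0) (at 0)"
      by (simp add: filterlim_split_at_real)
    with 3 show ?thesis
      by (simp add: flat_exp_def has_field_derivative_iff)
  qed
qed

text \<open>The rules are chosen so that the class is closed under partial derivatives; membership
  in \<^const>\<open>C_infinity\<close> then follows by induction on the order.\<close>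

inductive smooth_fun :: "('a::euclidean_space \<Rightarrow> real) \<Rightarrow> bool" where
  const: "smooth_fun (\<lambda>x. c)"
| inner: "smooth_fun (\<lambda>x. x \<bullet> b)"
| add: "smooth_fun f \<Longrightarrow> smooth_fun g \<Longrightarrow> smooth_fun (\<lambda>x. f x + g x)"
| mult: "smooth_fun f \<Longrightarrow> smooth_fun g \<Longrightarrow> smooth_fun (\<lambda>x. f x * g x)"
| flat_exp: "smooth_fun f \<Longrightarrow> smooth_fun (\<lambda>x. flat_exp k (f x))"
| powr: "smooth_fun f \<Longrightarrow> (\<And>x. f x > 0) \<Longrightarrow> smooth_fun (\<lambda>x. f x powr a)"

lemma smooth_fun_diff: "smooth_fun f \<Longrightarrow> smooth_fun g \<Longrightarrow> smooth_fun (\<lambda>x. f x - g x)"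
  using smooth_fun.add[OF _ smooth_fun.mult[OF smooth_fun.const[of "-1"]], of f g] by simp

lemma smooth_fun_sum:
  assumes "\<And>i. i \<in> I \<Longrightarrow> smooth_fun (f i)"
  shows "smooth_fun (\<lambda>x. \<Sum>i\<in>I. f i x)"
  using assms
  by (induction I rule: infinite_finite_induct) (auto intro: smooth_fun.const smooth_fun.add)

lemma smooth_fun_inner_self: "smooth_fun (\<lambda>x. (x - a) \<bullet> (x - a))"
proof -
  have "smooth_fun (\<lambda>x. \<Sum>b\<in>Basis. (x \<bullet> b - a \<bullet> b) * (x \<bullet> b - a \<bullet> b))"
    by (intro smooth_fun_sum smooth_fun.mult smooth_fun_diff smooth_fun.inner smooth_fun.const)
  then show ?thesis
    by (subst euclidean_inner) (simp add: inner_diff_left)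
qed

lemma smooth_fun_compose:
  fixes F :: "real \<Rightarrow> real"
  assumes "smooth_fun F" "smooth_fun f"
  shows "smooth_fun (\<lambda>x. F (f x))"
  using assms(1) by induction (auto intro: smooth_fun.intros assms(2))

text \<open>Rule induction: each differentiation rule yields only functions of the same class. In
  the \<open>flat_exp\<close> case only the index rises; in the \<open>powr\<close> case positivity
  of the base admits the new exponent a - 1.\<close>

lemma smooth_fun_derivative:
  assumes "smooth_fun f"
  shows "\<exists>f'. (\<forall>x. (f has_derivative f' x) (at x)) \<and> (\<forall>b. smooth_fun (\<lambda>x. f' x b))"
  using assms
proof induction
  case (const c)
  show ?case by (rule exI[of _ "\<lambda>x v. 0"]) (auto intro: smooth_fun.const)
next
  case (inner b)
  show ?case by (rule exI[of _ "\<lambda>x v. v \<bullet> b"])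
      (auto intro!: smooth_fun.const derivative_eq_intros)
next
  case (add f g)
  then obtain f' g' where "\<And>x. (f has_derivative f' x) (at x)" "\<And>b. smooth_fun (\<lambda>x. f' x b)"
    "\<And>x. (g has_derivative g' x) (at x)" "\<And>b. smooth_fun (\<lambda>x. g' x b)" by metis
  then show ?case
    by (intro exI[of _ "\<lambda>x v. f' x v + g' x v"])
      (auto intro!: has_derivative_add smooth_fun.add)
next
  case (mult f g)
  then obtain f' g' where "\<And>x. (f has_derivative f' x) (at x)" "\<And>b. smooth_fun (\<lambda>x. f' x b)"
    "\<And>x. (g has_derivative g' x) (at x)" "\<And>b. smooth_fun (\<lambda>x. g' x b)" by metis
  with mult show ?case
    by (intro exI[of _ "\<lambda>x v. f x * g' x v + f' x v * g x"])
      (auto intro!: has_derivative_mult smooth_fun.intros)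
next
  case (flat_exp f k)
  then obtain f' where f': "\<And>x. (f has_derivative f' x) (at x)" "\<And>b. smooth_fun (\<lambda>x. f' x b)"
    by metis
  let ?h = "\<lambda>r. flat_exp (k + 2) r - real k * flat_exp (k + 1) r"
  have "((\<lambda>x. flat_exp k (f x)) has_derivative (\<lambda>v. ?h (f x) * f' x v)) (at x)" for x
    using has_derivative_compose[OF f'(1) has_field_derivative_imp_has_derivative[OF flat_exp_has_derivative]]
    by simp
  then show ?case using flat_exp f'
    by (intro exI[of _ "\<lambda>x v. ?h (f x) * f' x v"])
      (auto intro!: smooth_fun.intros smooth_fun_diff)
next
  case (powr f a)
  then obtain f' where f': "\<And>x. (f has_derivative f' x) (at x)" "\<And>b. smooth_fun (\<lambda>x. f' x b)"
    by metis
  have "((\<lambda>x. f x powr a) has_derivative (\<lambda>v. (a * f x powr (a - 1)) * f' x v)) (at x)" for x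
    using has_derivative_compose[OF f'(1) has_field_derivative_imp_has_derivative[OF has_real_derivative_powr[OF powr(2)]]]
    by simp
  then show ?case using powr f'
    by (intro exI[of _ "\<lambda>x v. (a * f x powr (a - 1)) * f' x v"])
      (auto intro!: smooth_fun.intros)
qed

lemma smooth_fun_imp_C_infinity:
  assumes "smooth_fun f"
  shows "C_infinity f"
proof -
  have "C_k k f" if "smooth_fun f" for k and f :: "'a \<Rightarrow> real"
    using that
  proof (induction k arbitrary: f)
    case 0
    then obtain f' where "\<And>x. (f has_derivative f' x) (at x)"
      using smooth_fun_derivative by metis
    then show ?case
      by (auto intro!: continuous_at_imp_continuous_on has_derivative_continuous)
  next
    case (Suc k)
    then obtain f' where f': "\<And>x. (f has_derivative f' x) (at x)" "\<And>b. smooth_fun (\<lambda>x. f' x b)"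
      using smooth_fun_derivative by metis
    have "partial_deriv b f = (\<lambda>x. f' x b)" for b
      by (simp add: partial_deriv_def fun_eq_iff flip: frechet_derivative_at[OF f'(1)])
    with f' Suc.IH show ?case
      by (auto simp: differentiable_on_def differentiable_def)
  qed
  with assms show ?thesis
    by (simp add: C_infinity_def)
qed

subsection \<open>The Hardy inequality on star-shaped sets\<close>

lemma C_infinity_has_derivative:
  assumes "C_infinity \<phi>"
  shows "(\<phi> has_derivative (\<lambda>v. gradient \<phi> x \<bullet> v)) (at x)"
proof -
  have "C_k (Suc 0) \<phi>"
    using assms unfolding C_infinity_def by blast
  then have "(\<phi> has_derivative frechet_derivative \<phi> (at x)) (at x)"
    by (simp add: differentiable_on_def frechet_derivative_works)
  moreover have "frechet_derivative \<phi> (at x) = (\<lambda>v. gradient \<phi> x \<bullet> v)"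
  proof
    fix v
    interpret D: linear "frechet_derivative \<phi> (at x)"
      using calculation by (rule has_derivative_linear)
    have "frechet_derivative \<phi> (at x) v = frechet_derivative \<phi> (at x) (\<Sum>b\<in>Basis. (v \<bullet> b) *\<^sub>R b)"
      by (simp add: euclidean_representation)
    also have "\<dots> = gradient \<phi> x \<bullet> v"
      by (simp add: D.sum D.scale gradient_def partial_deriv_def inner_sum_right inner_commute[of _ v] mult.commute)
    finally show "frechet_derivative \<phi> (at x) v = gradient \<phi> x \<bullet> v" .
  qed
  ultimately show ?thesis by simp
qed

lemma C_infinity_continuous_gradient:
  assumes "C_infinity \<phi>"
  shows "continuous_on UNIV (gradient \<phi>)"
proof -
  have "C_k (Suc 0) \<phi>"
    using assms unfolding C_infinity_def by blast
  then show ?thesis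
    unfolding gradient_def by (auto intro!: continuous_intros)
qed

lemma gradient_eqI:
  assumes "(f has_derivative (\<lambda>v. w \<bullet> v)) (at x)"
  shows "gradient f x = w"
  unfolding gradient_def partial_deriv_def frechet_derivative_at[OF assms, symmetric]
  by (simp add: euclidean_representation)

lemma gradient_eq_0_outside_support:
  assumes "x \<notin> closure {x. \<phi> x \<noteq> 0}"
  shows "gradient \<phi> x = 0"
proof (rule gradient_eqI)
  have "((\<lambda>x. 0) has_derivative (\<lambda>v. 0)) (at x)" by simp
  then have "(\<phi> has_derivative (\<lambda>v. 0)) (at x)"
    by (rule has_derivative_transform_within_open[of _ _ _ _ "- closure {x. \<phi> x \<noteq> 0}"])
      (use assms closure_subset[of "{x. \<phi> x \<noteq> 0}"] in auto)
  then show "(\<phi> has_derivative (\<lambda>v. 0 \<bullet> v)) (at x)" by simp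
qed

section \<open>Change of variables and a weighted Jensen inequality\<close>

lemma nn_integral_lborel_affine:
  fixes f :: "'a::euclidean_space \<Rightarrow> ennreal"
  assumes [measurable]: "f \<in> borel_measurable borel" and "c \<noteq> 0"
  shows "(\<integral>\<^sup>+x. f x \<partial>lborel) = ennreal (\<bar>c\<bar> ^ DIM('a)) * (\<integral>\<^sup>+x. f (t + c *\<^sub>R x) \<partial>lborel)"
  by (subst lborel_affine[OF assms(2), of t])
     (simp add: nn_integral_density nn_integral_distr nn_integral_cmult)

text \<open>The graph of the convex function a^p lies above its tangent at b. Young's inequality
  with exponents p and p / (p - 1) gives exactly this.\<close>

lemma powr_tangent_le:
  fixes a b p :: real
  assumes "1 < p" "a \<ge> 0" "b \<ge> 0"
  shows "p * a * b powr (p - 1) \<le> a powr p + (p - 1) * b powr p"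
proof -
  have "a * b powr (p - 1) \<le> a powr p / p + (b powr (p - 1)) powr (p / (p - 1)) / (p / (p - 1))"
    by (rule Youngs_inequality) (use assms in \<open>auto simp: field_simps\<close>)
  also have "\<dots> = a powr p / p + b powr p / (p / (p - 1))"
    using assms by (simp add: powr_powr)
  finally show ?thesis
    using assms by (simp add: field_simps)
qed

lemma set_nn_integral_has_integral:
  fixes f :: "'a::euclidean_space \<Rightarrow> real"
  assumes [measurable]: "f \<in> borel_measurable borel" "S \<in> sets borel"
    and f: "\<And>x. f x \<ge> 0" "(f has_integral I) S"
  shows "(\<integral>\<^sup>+x\<in>S. ennreal (f x) \<partial>lborel) = ennreal I"
proof -
  have "((\<lambda>x. if x \<in> S then f x else 0) has_integral I) UNIV"
    using f(2) by (simp only: has_integral_restrict_UNIV)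
  then have "integral\<^sup>N lborel (\<lambda>x. ennreal (if x \<in> S then f x else 0)) = ennreal I"
    using f(1) by (intro nn_integral_has_integral_lborel) auto
  also have "(\<lambda>x. ennreal (if x \<in> S then f x else 0)) = (\<lambda>x. ennreal (f x) * indicator S x)"
    by (auto simp: indicator_def)
  finally show ?thesis .
qed

lemma nn_integral_powr_unit_interval:
  fixes \<kappa> :: real
  assumes "\<kappa> > 0"
  shows "(\<integral>\<^sup>+t\<in>{0..1}. ennreal (t powr (\<kappa> - 1)) \<partial>lborel) = ennreal (1 / \<kappa>)"
  using has_integral_powr_from_0[of "\<kappa> - 1" 1] assms
  by (intro set_nn_integral_has_integral) auto

text \<open>Jensen's inequality for the probability measure \<open>\<kappa> t\<^bsup>\<kappa> - 1\<^esup> dt\<close> on \<open>[0, 1]\<close>; this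
  weight is the one that produces the sharp constant.\<close>

lemma powr_integral_le_weighted:
  fixes h :: "real \<Rightarrow> real"
  assumes [measurable]: "h \<in> borel_measurable borel" and h: "\<And>t. h t \<ge> 0"
    and "1 < p" "\<kappa> > 0" "I \<ge> 0"
    and I: "(\<integral>\<^sup>+t\<in>{0..1}. ennreal (h t) \<partial>lborel) = ennreal I"
  shows "ennreal (I powr p) \<le> ennreal (\<kappa> powr (1 - p)) *
    (\<integral>\<^sup>+t\<in>{0..1}. ennreal (h t powr p * t powr ((p - 1) * (1 - \<kappa>))) \<partial>lborel)"
    (is "_ \<le> _ * ?X")
proof (cases "?X = top")
  case True
  then show ?thesis using \<open>\<kappa> > 0\<close> by (simp add: ennreal_mult_top)
next
  case False
  then obtain x where x: "?X = ennreal x" "x \<ge> 0"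
    by (cases ?X) auto
  \<comment> \<open>A is the mean of t^(1 - \<kappa>) h(t) under \<kappa> t^(\<kappa> - 1) dt.
    Integrating the tangent inequality taken at the mean proves Jensen's inequality.\<close>
  define A where "A = \<kappa> * I"
  have "A \<ge> 0" using assms by (simp add: A_def)
  have pointwise: "p * \<kappa> * A powr (p - 1) * h t
      \<le> \<kappa> * (h t powr p * t powr ((p - 1) * (1 - \<kappa>))) + \<kappa> * (p - 1) * A powr p * t powr (\<kappa> - 1)"
    if "t > 0" for t
  proof -
    have "p * (h t * t powr (1 - \<kappa>)) * A powr (p - 1) \<le> (h t * t powr (1 - \<kappa>)) powr p + (p - 1) * A powr p"
      using h \<open>A \<ge> 0\<close> \<open>1 < p\<close> by (intro powr_tangent_le) auto
    then have "\<kappa> * t powr (\<kappa> - 1) * (p * (h t * t powr (1 - \<kappa>)) * A powr (p - 1))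
       \<le> \<kappa> * t powr (\<kappa> - 1) * ((h t * t powr (1 - \<kappa>)) powr p + (p - 1) * A powr p)"
      using \<open>\<kappa> > 0\<close> by (intro mult_left_mono) auto
    also have "\<kappa> * t powr (\<kappa> - 1) * (p * (h t * t powr (1 - \<kappa>)) * A powr (p - 1))
        = p * \<kappa> * A powr (p - 1) * h t * (t powr (\<kappa> - 1) * t powr (1 - \<kappa>))"
      by (simp only: mult_ac)
    also have "t powr (\<kappa> - 1) * t powr (1 - \<kappa>) = 1"
      using that by (simp flip: powr_add)
    also have "\<kappa> * t powr (\<kappa> - 1) * ((h t * t powr (1 - \<kappa>)) powr p + (p - 1) * A powr p)
        = \<kappa> * (t powr (\<kappa> - 1) * (h t * t powr (1 - \<kappa>)) powr p) + \<kappa> * (p - 1) * A powr p * t powr (\<kappa> - 1)"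
      by (simp only: distrib_left mult_ac)
    also have "t powr (\<kappa> - 1) * (h t * t powr (1 - \<kappa>)) powr p = h t powr p * t powr ((p - 1) * (1 - \<kappa>))"
    proof -
      have "t powr (\<kappa> - 1) * (h t * t powr (1 - \<kappa>)) powr p
          = h t powr p * (t powr (\<kappa> - 1) * t powr ((1 - \<kappa>) * p))"
        using h that by (simp add: powr_mult powr_powr)
      also have "t powr (\<kappa> - 1) * t powr ((1 - \<kappa>) * p) = t powr (\<kappa> - 1 + (1 - \<kappa>) * p)"
        by (rule powr_add[symmetric])
      also have "\<kappa> - 1 + (1 - \<kappa>) * p = (p - 1) * (1 - \<kappa>)" by (simp add: algebra_simps)
      finally show ?thesis .
    qed
    finally show ?thesis by simp
  qed
  have "ennreal (p * A powr p) = ennreal (p * \<kappa> * A powr (p - 1)) * ennreal I"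
  proof -
    have "A powr p = A powr (p - 1) * A"
      using \<open>A \<ge> 0\<close> by (cases "A = 0") (auto simp: powr_diff)
    then show ?thesis
      using assms by (simp add: A_def ennreal_mult''[symmetric] mult_ac)
  qed
  also have "\<dots> = (\<integral>\<^sup>+t\<in>{0..1}. ennreal (p * \<kappa> * A powr (p - 1) * h t) \<partial>lborel)"
    unfolding I[symmetric]
    by (subst nn_integral_cmult[symmetric]) (use assms in \<open>auto simp: ennreal_mult'' mult.assoc\<close>)
  also have "\<dots> \<le> (\<integral>\<^sup>+t. ennreal \<kappa> * (ennreal (h t powr p * t powr ((p - 1) * (1 - \<kappa>))) * indicator {0..1} t)
      + ennreal (\<kappa> * (p - 1) * A powr p) * (ennreal (t powr (\<kappa> - 1)) * indicator {0..1} t) \<partial>lborel)"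
  \<comment> \<open>The point t = 0 has to be discarded: there \<open>0 powr a = 0\<close> makes the
    right side vanish, while \<open>h 0\<close> may be positive.\<close>
  proof (rule nn_integral_mono_AE)
    show "AE t in lborel. ennreal (p * \<kappa> * A powr (p - 1) * h t) * indicator {0..1} t
      \<le> ennreal \<kappa> * (ennreal (h t powr p * t powr ((p - 1) * (1 - \<kappa>))) * indicator {0..1} t)
      + ennreal (\<kappa> * (p - 1) * A powr p) * (ennreal (t powr (\<kappa> - 1)) * indicator {0..1} t)"
      using AE_lborel_singleton[of 0]
    proof eventually_elim
      case (elim t)
      then show ?case
        using pointwise[of t] assms \<open>A \<ge> 0\<close>
        by (auto simp: indicator_def ennreal_mult[symmetric] ennreal_plus[symmetric] simp del: ennreal_plus intro!: ennreal_leI)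
    qed
  qed
  also have "\<dots> = ennreal \<kappa> * ?X + ennreal (\<kappa> * (p - 1) * A powr p) * ennreal (1 / \<kappa>)"
    by (simp add: nn_integral_add nn_integral_cmult nn_integral_powr_unit_interval \<open>\<kappa> > 0\<close>)
  also have "\<dots> = ennreal (\<kappa> * x + (p - 1) * A powr p)"
    using assms x by (simp add: ennreal_mult[symmetric] ennreal_plus[symmetric] del: ennreal_plus)
  \<comment> \<open>All terms are finite reals by now, so (p - 1) A^p can be cancelled from both
    sides.\<close>
  finally have "p * A powr p \<le> \<kappa> * x + (p - 1) * A powr p"
    using assms x by (subst (asm) ennreal_le_iff) auto
  then have "\<kappa> powr p * I powr p \<le> \<kappa> * x"
    using assms by (simp add: A_def powr_mult algebra_simps)
  then have "I powr p \<le> \<kappa> powr (1 - p) * x"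
    using \<open>\<kappa> > 0\<close> by (simp add: powr_diff field_simps)
  then show ?thesis
    using x by (simp add: ennreal_mult[symmetric])
qed

text \<open>Fundamental theorem of calculus along the segment from y to x, followed by
  Cauchy-Schwarz. The integral is handed out as a real I together with its \<open>ennreal\<close>
  form, as \<open>powr_integral_le_weighted\<close> expects it.\<close>

lemma abs_le_integral_gradient:
  fixes \<phi> :: "'a::euclidean_space \<Rightarrow> real"
  assumes \<phi>: "C_infinity \<phi>" and "\<phi> y = 0"
  obtains I where "I \<ge> 0"
    "(\<integral>\<^sup>+t\<in>{0..1}. ennreal (norm (gradient \<phi> (y + t *\<^sub>R (x - y)))) \<partial>lborel) = ennreal I"
    "\<bar>\<phi> x\<bar> \<le> norm (x - y) * I"
proof -
  define g where "g t = gradient \<phi> (y + t *\<^sub>R (x - y))" for t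
  have cont: "continuous_on UNIV g"
    unfolding g_def
    by (intro continuous_on_compose2[OF C_infinity_continuous_gradient[OF \<phi>]] continuous_intros) auto
  then have cont': "continuous_on {0..1} g"
    by (rule continuous_on_subset) auto
  have [measurable]: "g \<in> borel_measurable borel"
    using cont by (rule borel_measurable_continuous_onI)
  define I where "I = integral {0..1} (\<lambda>t. norm (g t))"
  have I: "((\<lambda>t. norm (g t)) has_integral I) {0..1}"
    unfolding I_def by (intro integrable_integral integrable_continuous_real continuous_intros cont')
  have "((\<lambda>t. \<phi> (y + t *\<^sub>R (x - y))) has_vector_derivative g t \<bullet> (x - y)) (at t within {0..1})" for t
  proof -
    have "((\<lambda>t. y + t *\<^sub>R (x - y)) has_derivative (\<lambda>s. s *\<^sub>R (x - y))) (at t within {0..1})"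
      by (auto intro!: derivative_eq_intros)
    from has_derivative_compose[OF this C_infinity_has_derivative[OF \<phi>]]
    show ?thesis by (simp add: has_vector_derivative_def g_def)
  qed
  then have "((\<lambda>t. g t \<bullet> (x - y)) has_integral (\<phi> (y + 1 *\<^sub>R (x - y)) - \<phi> (y + 0 *\<^sub>R (x - y)))) {0..1}"
    by (intro fundamental_theorem_of_calculus) auto
  then have \<phi>x: "((\<lambda>t. g t \<bullet> (x - y)) has_integral \<phi> x) {0..1}"
    using assms by simp
  have "norm (integral {0..1} (\<lambda>t. g t \<bullet> (x - y))) \<le> integral {0..1} (\<lambda>t. norm (x - y) * norm (g t))"
    using \<phi>x I by (intro integral_norm_bound_integral)
      (auto simp: has_integral_integrable integrable_on_cmult_left mult.commute[of "norm (x - y)"]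
        intro!: Cauchy_Schwarz_ineq2 has_integral_integrable[OF has_integral_mult_left])
  then have "\<bar>\<phi> x\<bar> \<le> norm (x - y) * I"
    using \<phi>x by (simp add: I_def integral_unique)
  moreover have "(\<integral>\<^sup>+t\<in>{0..1}. ennreal (norm (g t)) \<partial>lborel) = ennreal I"
    using I by (intro set_nn_integral_has_integral) auto
  moreover have "I \<ge> 0"
    using I by (rule has_integral_nonneg) auto
  ultimately show ?thesis
    using that by (simp add: g_def)
qed

text \<open>The constant comes from two sources: Jensen costs \<kappa>^(1 - p) and the integral of
  t^(\<kappa> - 1) over the unit interval costs 1 / \<kappa>, together \<kappa>^(-p). Positivity of
  \<kappa> is what makes that integral converge at 0.\<close>

lemma hardy_star_shaped:
  fixes \<phi> :: "'a::euclidean_space \<Rightarrow> real"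
  assumes \<phi>: "C_infinity \<phi>" and "\<phi> y = 0" and [measurable]: "C \<in> sets borel"
    and star: "\<And>x t. x \<in> C \<Longrightarrow> 0 < t \<Longrightarrow> t \<le> 1 \<Longrightarrow> y + t *\<^sub>R (x - y) \<in> C"
    and "1 < p" and \<kappa>: "\<kappa> = (\<alpha> + p - real DIM('a)) / p" "\<kappa> > 0"
  shows "ennreal (\<kappa> powr p) * (\<integral>\<^sup>+x\<in>C. ennreal (\<bar>\<phi> x\<bar> powr p / norm (x - y) powr (p + \<alpha>)) \<partial>lborel)
    \<le> (\<integral>\<^sup>+x\<in>C. ennreal (norm (gradient \<phi> x) powr p / norm (x - y) powr \<alpha>) \<partial>lborel)"
    (is "_ * ?L \<le> ?J")
proof -
  let ?n = "DIM('a)"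
  define g where "g x = norm (gradient \<phi> x)" for x
  have g_nonneg: "g x \<ge> 0" for x by (simp add: g_def)
  have "continuous_on UNIV g"
    unfolding g_def by (intro continuous_intros C_infinity_continuous_gradient \<phi>)
  then have [measurable]: "g \<in> borel_measurable borel"
    by (rule borel_measurable_continuous_onI)
  define e where "e = (p - 1) * (1 - \<kappa>)"
  \<comment> \<open>Jensen leaves a factor t^e and the dilation by t contributes t^(\<alpha> - n).
    The value of \<kappa> is the one for which their product is again the Jensen weight t^(\<kappa>
    - 1).\<close>
  have e: "e + (\<alpha> - ?n) = \<kappa> - 1"
    using \<open>1 < p\<close> unfolding e_def \<kappa> by (simp add: field_simps)
  let ?G = "\<lambda>t x. ennreal (g (y + t *\<^sub>R (x - y)) powr p / norm (x - y) powr \<alpha>)"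
  have bound: "ennreal (\<bar>\<phi> x\<bar> powr p / norm (x - y) powr (p + \<alpha>))
      \<le> ennreal (\<kappa> powr (1 - p)) * (\<integral>\<^sup>+t. ennreal (t powr e) * indicator {0..1} t * ?G t x \<partial>lborel)" for x
  proof (cases "x = y")
    case False
    obtain I where I: "I \<ge> 0"
      "(\<integral>\<^sup>+t\<in>{0..1}. ennreal (g (y + t *\<^sub>R (x - y))) \<partial>lborel) = ennreal I"
      "\<bar>\<phi> x\<bar> \<le> norm (x - y) * I"
      unfolding g_def by (rule abs_le_integral_gradient[OF \<phi> \<open>\<phi> y = 0\<close>])
    have "\<bar>\<phi> x\<bar> powr p \<le> (norm (x - y) * I) powr p"
      using I \<open>1 < p\<close> by (intro powr_mono2) auto
    then have "\<bar>\<phi> x\<bar> powr p / norm (x - y) powr (p + \<alpha>) \<le> (1 / norm (x - y) powr \<alpha>) * I powr p"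
      using False I by (simp add: powr_add powr_mult field_simps)
    then have "ennreal (\<bar>\<phi> x\<bar> powr p / norm (x - y) powr (p + \<alpha>))
        \<le> ennreal (1 / norm (x - y) powr \<alpha>) * ennreal (I powr p)"
      by (subst ennreal_mult[symmetric]) (auto intro: ennreal_leI)
    also have "\<dots> \<le> ennreal (1 / norm (x - y) powr \<alpha>) * (ennreal (\<kappa> powr (1 - p)) *
      (\<integral>\<^sup>+t\<in>{0..1}. ennreal (g (y + t *\<^sub>R (x - y)) powr p * t powr e) \<partial>lborel))"
      unfolding e_def using I \<kappa> \<open>1 < p\<close>
      by (intro mult_left_mono powr_integral_le_weighted) (auto simp: g_nonneg)
    also have "\<dots> = ennreal (\<kappa> powr (1 - p)) * (\<integral>\<^sup>+t. ennreal (1 / norm (x - y) powr \<alpha>) *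
         (ennreal (g (y + t *\<^sub>R (x - y)) powr p * t powr e) * indicator {0..1} t) \<partial>lborel)"
      by (subst nn_integral_cmult) (auto simp: mult_ac)
    also have "(\<lambda>t. ennreal (1 / norm (x - y) powr \<alpha>) *
         (ennreal (g (y + t *\<^sub>R (x - y)) powr p * t powr e) * indicator {0..1} t))
        = (\<lambda>t. ennreal (t powr e) * indicator {0..1} t * ?G t x)"
      by (auto simp: indicator_def ennreal_mult[symmetric] mult_ac)
    finally show ?thesis .
  qed (simp add: \<open>\<phi> y = 0\<close>)
  \<comment> \<open>Substituting the dilated point, the Jacobian gives t^(-n) and the weight gives
    t^\<alpha>. The dilated copy of C lies inside C, hence an inequality.\<close>
  have scale: "(\<integral>\<^sup>+x\<in>C. ?G t x \<partial>lborel) \<le> ennreal (t powr (\<alpha> - ?n)) * ?J" if "0 < t" "t \<le> 1" for t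
  proof -
    have "?J = (\<integral>\<^sup>+x. ennreal (g x powr p / norm (x - y) powr \<alpha>) * indicator C x \<partial>lborel)"
      by (simp add: g_def)
    also have "\<dots> = ennreal (\<bar>t\<bar> ^ ?n) * (\<integral>\<^sup>+x. ennreal (g (y - t *\<^sub>R y + t *\<^sub>R x) powr p / norm (y - t *\<^sub>R y + t *\<^sub>R x - y) powr \<alpha>)
        * indicator C (y - t *\<^sub>R y + t *\<^sub>R x) \<partial>lborel)"
      by (rule nn_integral_lborel_affine) (use that in auto)
    also have "\<dots> = ennreal (\<bar>t\<bar> ^ ?n) * (\<integral>\<^sup>+x. ennreal (t powr - \<alpha>) * (?G t x * indicator C (y + t *\<^sub>R (x - y))) \<partial>lborel)"
    proof -
      have 1: "y - t *\<^sub>R y + t *\<^sub>R x = y + t *\<^sub>R (x - y)" for x by (simp add: algebra_simps)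
      have 2: "ennreal (g (y + t *\<^sub>R (x - y)) powr p / norm (t *\<^sub>R (x - y)) powr \<alpha>)
         = ennreal (t powr - \<alpha>) * ?G t x" for x
      proof -
        have "norm (t *\<^sub>R (x - y)) = t * norm (x - y)"
          using that by simp
        then show ?thesis
          using that by (simp add: ennreal_mult[symmetric] powr_mult powr_minus divide_inverse mult_ac
            del: norm_scaleR)
      qed
      show ?thesis
        unfolding 1 add_diff_cancel_left' 2 by (simp only: mult.assoc)
    qed
    also have "\<dots> = ennreal (t ^ ?n * t powr - \<alpha>) * (\<integral>\<^sup>+x. ?G t x * indicator C (y + t *\<^sub>R (x - y)) \<partial>lborel)"
      using that by (subst nn_integral_cmult) (auto simp: ennreal_mult mult.assoc)
    finally have J: "?J = ennreal (t ^ ?n * t powr - \<alpha>) * (\<integral>\<^sup>+x. ?G t x * indicator C (y + t *\<^sub>R (x - y)) \<partial>lborel)" .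
    have "t powr (\<alpha> - ?n) * (t ^ ?n * t powr - \<alpha>) = 1"
      using that by (simp flip: powr_realpow powr_add)
    then have "ennreal (t powr (\<alpha> - ?n)) * ?J = (\<integral>\<^sup>+x. ?G t x * indicator C (y + t *\<^sub>R (x - y)) \<partial>lborel)"
      unfolding J using that
      by (simp only: mult.assoc[symmetric, of "ennreal _"] ennreal_mult[symmetric] powr_ge_zero
          mult_nonneg_nonneg zero_le_power less_imp_le) simp
    also have "\<dots> \<ge> (\<integral>\<^sup>+x\<in>C. ?G t x \<partial>lborel)"
      using star that by (intro nn_integral_mono) (auto simp: indicator_def)
    finally show ?thesis .
  qed
  have "?L \<le> (\<integral>\<^sup>+x. ennreal (\<kappa> powr (1 - p)) * (\<integral>\<^sup>+t. ennreal (t powr e) * indicator {0..1} t * ?G t x \<partial>lborel) * indicator C x \<partial>lborel)"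
    by (intro nn_integral_mono mult_right_mono bound) auto
  also have "\<dots> = ennreal (\<kappa> powr (1 - p)) * (\<integral>\<^sup>+x. (\<integral>\<^sup>+t. ennreal (t powr e) * indicator {0..1} t * (?G t x * indicator C x) \<partial>lborel) \<partial>lborel)"
    by (subst nn_integral_cmult[symmetric]) (auto simp: nn_integral_multc[symmetric] mult.assoc)
  also have "(\<integral>\<^sup>+x. (\<integral>\<^sup>+t. ennreal (t powr e) * indicator {0..1} t * (?G t x * indicator C x) \<partial>lborel) \<partial>lborel)
     = (\<integral>\<^sup>+t. (\<integral>\<^sup>+x. ennreal (t powr e) * indicator {0..1} t * (?G t x * indicator C x) \<partial>lborel) \<partial>lborel)"
    by (rule lborel_pair.Fubini'[symmetric]) measurable
  also have "\<dots> = (\<integral>\<^sup>+t. ennreal (t powr e) * indicator {0..1} t * (\<integral>\<^sup>+x\<in>C. ?G t x \<partial>lborel) \<partial>lborel)"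
    by (subst nn_integral_cmult) auto
  also have "\<dots> \<le> (\<integral>\<^sup>+t. ennreal (t powr (\<kappa> - 1)) * indicator {0..1} t * ?J \<partial>lborel)"
  proof (rule nn_integral_mono_AE)
    show "AE t in lborel. ennreal (t powr e) * indicator {0..1} t * (\<integral>\<^sup>+x\<in>C. ?G t x \<partial>lborel)
        \<le> ennreal (t powr (\<kappa> - 1)) * indicator {0..1} t * ?J"
      using AE_lborel_singleton[of 0]
    proof eventually_elim
      case (elim t)
      show ?case
      proof (cases "t \<in> {0..1}")
        case True
        with elim have t: "0 < t" "t \<le> 1" by auto
        have "ennreal (t powr e) * (\<integral>\<^sup>+x\<in>C. ?G t x \<partial>lborel) \<le> ennreal (t powr e) * (ennreal (t powr (\<alpha> - ?n)) * ?J)"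
          by (intro mult_left_mono scale t) auto
        also have "\<dots> = ennreal (t powr (\<kappa> - 1)) * ?J"
          unfolding e[symmetric] by (simp add: powr_add ennreal_mult mult.assoc)
        finally show ?thesis using True by simp
      qed simp
    qed
  qed
  also have "\<dots> = ennreal (1 / \<kappa>) * ?J"
    by (subst nn_integral_multc) (auto simp: nn_integral_powr_unit_interval \<kappa>(2))
  finally have "?L \<le> ennreal (\<kappa> powr (1 - p)) * (ennreal (1 / \<kappa>) * ?J)"
    by (simp add: mult_left_mono)
  then have "ennreal (\<kappa> powr p) * ?L \<le> ennreal (\<kappa> powr p) * (ennreal (\<kappa> powr (1 - p)) * (ennreal (1 / \<kappa>) * ?J))"
    by (rule mult_left_mono) auto
  also have "\<dots> = ennreal (\<kappa> powr p * \<kappa> powr (1 - p) * (1 / \<kappa>)) * ?J"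
    using \<kappa>(2) by (simp add: ennreal_mult'' mult.assoc del: times_divide_eq_right)
  also have "\<kappa> powr p * \<kappa> powr (1 - p) * (1 / \<kappa>) = 1"
    using \<kappa>(2) by (simp flip: powr_add)
  finally show ?thesis by simp
qed

subsection \<open>Voronoi cells of boundary points\<close>

text \<open>Ties between nearest points are broken by the ranking \<open>r\<close>, which makes the cells disjoint.\<close>

definition voronoi_cell :: "'a::euclidean_space set \<Rightarrow> ('a \<Rightarrow> nat) \<Rightarrow> 'a \<Rightarrow> 'a set" where
  "voronoi_cell Z r z = {x. \<forall>w\<in>Z. dist x z < dist x w \<or> dist x z = dist x w \<and> r z \<le> r w}"

lemma voronoi_cell_nearest:
  assumes "x \<in> voronoi_cell Z r z" "w \<in> Z"
  shows "dist x z \<le> dist x w"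
  using assms by (force simp: voronoi_cell_def)

lemma sets_voronoi_cell:
  assumes "finite Z"
  shows "voronoi_cell Z r z \<in> sets borel"
proof -
  have "voronoi_cell Z r z = (\<Inter>w\<in>Z. {x. dist x z < dist x w} \<union> (if r z \<le> r w then {x. dist x z = dist x w} else {}))"
    by (auto simp: voronoi_cell_def split: if_splits)
  moreover have "{x. dist x z < dist x w} \<union> (if r z \<le> r w then {x. dist x z = dist x w} else {}) \<in> sets borel" for w
    using borel_open[OF open_Collect_less[of "\<lambda>x. dist x z" "\<lambda>x. dist x w"]]
      borel_closed[OF closed_Collect_eq[of "\<lambda>x. dist x z" "\<lambda>x. dist x w"]]
    by (auto intro!: sets.Un continuous_intros)
  ultimately show ?thesis
    using assms by (cases "Z = {}") (auto intro!: sets.finite_INT)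
qed

text \<open>Moving from x towards z by a length s shortens the distance to z by exactly s, and the
  distance to any other w by at most s. So strict comparisons and ties broken by rank both
  survive.\<close>

lemma voronoi_cell_star_shaped:
  assumes "x \<in> voronoi_cell Z r z" "0 < t" "t \<le> 1"
  shows "z + t *\<^sub>R (x - z) \<in> voronoi_cell Z r z"
  unfolding voronoi_cell_def
proof (intro CollectI ballI)
  fix w assume "w \<in> Z"
  let ?y = "z + t *\<^sub>R (x - z)"
  have yz: "dist ?y z = t * dist x z"
    using assms by (simp add: dist_norm)
  have "x - ?y = (1 - t) *\<^sub>R (x - z)" by (simp add: algebra_simps)
  then have "dist x ?y = (1 - t) * dist x z"
    using assms by (simp add: dist_norm)
  moreover have "dist x w \<le> dist x ?y + dist ?y w" by (rule dist_triangle)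
  ultimately have "dist ?y w \<ge> dist x w - (dist x z - t * dist x z)"
    by (simp add: algebra_simps)
  moreover have "dist x z < dist x w \<or> dist x z = dist x w \<and> r z \<le> r w"
    using assms \<open>w \<in> Z\<close> by (auto simp: voronoi_cell_def)
  ultimately show "dist ?y z < dist ?y w \<or> dist ?y z = dist ?y w \<and> r z \<le> r w"
    using yz by linarith
qed

text \<open>Existence minimises the distance first and then the rank among the nearest points. Two
  winners would tie in both, which injectivity of r excludes.\<close>

lemma ex1_voronoi_cell:
  assumes "finite Z" "Z \<noteq> {}" "inj_on r Z"
  shows "\<exists>!z. z \<in> Z \<and> x \<in> voronoi_cell Z r z"
proof (rule ex_ex1I)
  obtain m where m: "m \<in> Z" "\<And>w. w \<in> Z \<Longrightarrow> dist x m \<le> dist x w"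
    using ex_is_arg_min_if_finite[OF assms(1,2), of "dist x"] by (auto simp: is_arg_min_linorder)
  let ?N = "{z\<in>Z. dist x z = dist x m}"
  have "finite ?N" "?N \<noteq> {}" using assms m by auto
  then obtain z where z: "z \<in> ?N" "\<And>w. w \<in> ?N \<Longrightarrow> r z \<le> r w"
    using ex_is_arg_min_if_finite[of ?N r] by (auto simp: is_arg_min_linorder)
  have "x \<in> voronoi_cell Z r z"
    unfolding voronoi_cell_def
  proof (intro CollectI ballI)
    fix w assume "w \<in> Z"
    with m(2)[of w] z(1) z(2)[of w] show "dist x z < dist x w \<or> dist x z = dist x w \<and> r z \<le> r w"
      by auto
  qed
  with z show "\<exists>z. z \<in> Z \<and> x \<in> voronoi_cell Z r z" by auto
next
  fix z w assume *: "z \<in> Z \<and> x \<in> voronoi_cell Z r z" "w \<in> Z \<and> x \<in> voronoi_cell Z r w"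
  from * have "dist x z < dist x w \<or> dist x z = dist x w \<and> r z \<le> r w"
    "dist x w < dist x z \<or> dist x w = dist x z \<and> r w \<le> r z"
    unfolding voronoi_cell_def by blast+
  then have "r z = r w" by linarith
  with * assms(3) show "z = w" by (auto dest: inj_onD)
qed

lemma sum_indicator_voronoi_cell:
  assumes "finite Z" "Z \<noteq> {}" "inj_on r Z"
  shows "(\<Sum>z\<in>Z. indicator (voronoi_cell Z r z) x) = (1::ennreal)"
proof -
  obtain z where z: "z \<in> Z" "x \<in> voronoi_cell Z r z" "\<And>w. w \<in> Z \<Longrightarrow> x \<in> voronoi_cell Z r w \<Longrightarrow> w = z"
    using ex1_voronoi_cell[OF assms, of x] by blast
  have "indicator (voronoi_cell Z r w) x = (if w = z then 1 else (0::ennreal))" if "w \<in> Z" for w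
  proof (cases "w = z")
    case False
    then have "x \<notin> voronoi_cell Z r w" using z(3)[OF that] by blast
    with False show ?thesis by simp
  qed (simp add: z(2))
  then have "(\<Sum>w\<in>Z. indicator (voronoi_cell Z r w) x) = (\<Sum>w\<in>Z. if w = z then 1 else (0::ennreal))"
    by (intro sum.cong) auto
  also have "\<dots> = 1"
    using assms(1) z(1) by simp
  finally show ?thesis .
qed

lemma nn_integral_voronoi_cells:
  assumes "finite Z" "Z \<noteq> {}" "inj_on r Z" and [measurable]: "F \<in> borel_measurable borel"
  shows "(\<integral>\<^sup>+x. F x \<partial>lborel) = (\<Sum>z\<in>Z. \<integral>\<^sup>+x\<in>voronoi_cell Z r z. F x \<partial>lborel)"
proof -
  note [measurable] = sets_voronoi_cell[OF assms(1)]
  have "(\<integral>\<^sup>+x. F x \<partial>lborel) = (\<integral>\<^sup>+x. (\<Sum>z\<in>Z. F x * indicator (voronoi_cell Z r z) x) \<partial>lborel)"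
    by (simp add: sum_indicator_voronoi_cell[OF assms(1-3)] flip: sum_distrib_left)
  also have "\<dots> = (\<Sum>z\<in>Z. \<integral>\<^sup>+x\<in>voronoi_cell Z r z. F x \<partial>lborel)"
    by (rule nn_integral_sum) auto
  finally show ?thesis .
qed

section \<open>The distance to the boundary and the inequality on general domains\<close>

lemma frontier_nonempty:
  assumes "is_domain \<Omega>" "\<Omega> \<noteq> UNIV"
  shows "frontier \<Omega> \<noteq> {}"
  using assms by (auto simp: is_domain_def frontier_eq_empty)

text \<open>The frontier must be known to be nonempty, since \<open>infdist\<close> to the empty set
  is 0 by convention. Openness of \<Omega> keeps x off the closed frontier.\<close>

lemma bdist_pos:
  assumes "is_domain \<Omega>" "\<Omega> \<noteq> UNIV" "x \<in> \<Omega>"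
  shows "bdist \<Omega> x > 0"
proof -
  have "x \<notin> frontier \<Omega>"
    using assms by (auto simp: is_domain_def frontier_def interior_open)
  then show ?thesis
    unfolding bdist_def using frontier_nonempty[OF assms(1,2)]
    by (intro infdist_pos_not_in_closed) auto
qed

lemma continuous_on_bdist: "continuous_on A (bdist \<Omega>)"
  unfolding bdist_def by (intro continuous_intros)

text \<open>A nearest boundary point of x satisfies the bound strictly, because the distance is
  positive and \<eta> > 0. The strict bound persists near x, so the sets \<open>?U y\<close> form an
  open cover of the compact set K.\<close>

lemma finite_approx_frontier:
  assumes \<Omega>: "is_domain \<Omega>" "\<Omega> \<noteq> UNIV" and K: "compact K" "K \<subseteq> \<Omega>" and "\<eta> > 0"
  obtains Z where "finite Z" "Z \<noteq> {}" "Z \<subseteq> frontier \<Omega>"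
    "\<And>x. x \<in> K \<Longrightarrow> \<exists>z\<in>Z. dist x z \<le> (1 + \<eta>) * bdist \<Omega> x"
proof -
  obtain y0 where y0: "y0 \<in> frontier \<Omega>"
    using frontier_nonempty[OF \<Omega>] by blast
  let ?U = "\<lambda>y. {x. dist x y < (1 + \<eta>) * bdist \<Omega> x}"
  have "\<exists>y\<in>frontier \<Omega>. x \<in> ?U y" if "x \<in> K" for x
  proof -
    obtain y where "y \<in> frontier \<Omega>" "bdist \<Omega> x = dist x y"
      unfolding bdist_def using infdist_attains_inf[of "frontier \<Omega>" x] y0 by auto
    moreover have "bdist \<Omega> x > 0" using that K bdist_pos[OF \<Omega>] by auto
    ultimately have "dist x y < (1 + \<eta>) * bdist \<Omega> x"
      using \<open>\<eta> > 0\<close> by (simp add: algebra_simps)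
    with \<open>y \<in> frontier \<Omega>\<close> show ?thesis by blast
  qed
  then have cover: "K \<subseteq> (\<Union>y\<in>frontier \<Omega>. ?U y)" by auto
  have open_U: "open (?U y)" for y
    by (intro open_Collect_less continuous_intros continuous_on_bdist)
  obtain Z where Z: "Z \<subseteq> frontier \<Omega>" "finite Z" "K \<subseteq> (\<Union>y\<in>Z. ?U y)"
    by (rule compactE_image[OF K(1) open_U cover])
  show ?thesis
  \<comment> \<open>Adding \<open>y0\<close> keeps the set nonempty even when K is empty, as for the
    zero test function.\<close>
  proof (rule that[of "insert y0 Z"])
    fix x assume "x \<in> K"
    then obtain z where "z \<in> Z" "dist x z < (1 + \<eta>) * bdist \<Omega> x" using Z(3) by auto
    then show "\<exists>z\<in>insert y0 Z. dist x z \<le> (1 + \<eta>) * bdist \<Omega> x" by (auto intro: less_imp_le)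
  qed (use Z y0 in auto)
qed

lemma weighted_hardy_ineq_domain:
  fixes \<Omega> :: "'a::euclidean_space set"
  assumes \<Omega>: "is_domain \<Omega>" "\<Omega> \<noteq> UNIV" and p: "1 < p" "\<alpha> + p > real DIM('a)"
  shows "weighted_hardy_ineq p \<alpha> \<Omega> (((\<alpha> + p - real DIM('a)) / p) powr p)"
  unfolding weighted_hardy_ineq_def
proof
  fix \<phi> assume "\<phi> \<in> test_functions \<Omega>"
  define K where "K = closure {x. \<phi> x \<noteq> 0}"
  have \<phi>: "C_infinity \<phi>" and K: "compact K" "K \<subseteq> \<Omega>"
    using \<open>\<phi> \<in> test_functions \<Omega>\<close> by (auto simp: test_functions_def K_def)
  have outside: "\<phi> x = 0" "gradient \<phi> x = 0" if "x \<notin> K" for x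
    using that gradient_eq_0_outside_support[of x \<phi>] closure_subset[of "{x. \<phi> x \<noteq> 0}"]
    by (auto simp: K_def)
  define \<kappa> where "\<kappa> = (\<alpha> + p - real DIM('a)) / p"
  have "\<kappa> > 0" using p by (simp add: \<kappa>_def)
  define d where "d = bdist \<Omega>"
  have d_pos: "d x > 0" if "x \<in> K" for x
    using that K bdist_pos[OF \<Omega>] by (auto simp: d_def)
  have [measurable]: "d \<in> borel_measurable borel"
    unfolding d_def by (intro borel_measurable_continuous_onI continuous_on_bdist)
  have [measurable]: "gradient \<phi> \<in> borel_measurable borel"
    by (intro borel_measurable_continuous_onI C_infinity_continuous_gradient \<phi>)
  have [measurable]: "\<phi> \<in> borel_measurable borel"
    by (intro borel_measurable_continuous_onI continuous_at_imp_continuous_on ballI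
        has_derivative_continuous[OF C_infinity_has_derivative[OF \<phi>]])
  have [measurable]: "\<Omega> \<in> sets borel"
    using \<Omega> by (simp add: is_domain_def)
  let ?F = "\<lambda>x. ennreal (\<bar>\<phi> x\<bar> powr p / d x powr (p + \<alpha>)) * indicator \<Omega> x"
  let ?G = "\<lambda>x. ennreal (norm (gradient \<phi> x) powr p / d x powr \<alpha>) * indicator \<Omega> x"
  \<comment> \<open>Exchanging d for the distance to the centre of the cell costs (1 + \<eta>)^(p +
    \<alpha>) on the function side and at most (1 + \<eta>)^\<bar>\<alpha>\<bar> on the gradient
    side.\<close>
  define q where "q = p + \<alpha> + \<bar>\<alpha>\<bar>"
  have approx: "ennreal (\<kappa> powr p) * (\<integral>\<^sup>+x. ?F x \<partial>lborel) \<le> ennreal ((1 + \<eta>) powr q) * (\<integral>\<^sup>+x. ?G x \<partial>lborel)"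
    if "\<eta> > 0" for \<eta>
  proof -
    obtain Z where Z: "finite Z" "Z \<noteq> {}" "Z \<subseteq> frontier \<Omega>"
      "\<And>x. x \<in> K \<Longrightarrow> \<exists>z\<in>Z. dist x z \<le> (1 + \<eta>) * d x"
      using finite_approx_frontier[OF \<Omega> K \<open>\<eta> > 0\<close>] unfolding d_def by blast
    obtain r :: "'a \<Rightarrow> nat" where r: "inj_on r Z"
      using finite_imp_inj_to_nat_seg[OF Z(1)] by blast
    define C where "C = voronoi_cell Z r"
    have [measurable]: "C z \<in> sets borel" for z
      unfolding C_def by (rule sets_voronoi_cell[OF Z(1)])
    have lower: "d x \<le> dist x z" if "z \<in> Z" for x z
      unfolding d_def bdist_def using that Z(3) by (intro infdist_le) auto
    have upper: "dist x z \<le> (1 + \<eta>) * d x" if xz: "x \<in> C z" "x \<in> K" for x z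
    proof -
      obtain w where "w \<in> Z" "dist x w \<le> (1 + \<eta>) * d x"
        using Z(4)[OF xz(2)] by blast
      with voronoi_cell_nearest[of x Z r z w] xz(1) show ?thesis
        unfolding C_def by linarith
    qed
    have frac: "1 / a \<le> e / b" if "b \<le> e * a" "a > 0" "b > 0" for a b e :: real
      using that by (simp add: field_simps)
    have F_le: "?F x * indicator (C z) x \<le> ennreal ((1 + \<eta>) powr (p + \<alpha>)) *
        (ennreal (\<bar>\<phi> x\<bar> powr p / norm (x - z) powr (p + \<alpha>)) * indicator (C z) x)" if "z \<in> Z" for x z
    proof (cases "x \<in> C z \<and> x \<in> K")
      case True
      then have "dist x z powr (p + \<alpha>) \<le> ((1 + \<eta>) * d x) powr (p + \<alpha>)"
        using upper p by (intro powr_mono2) auto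
      also have "\<dots> = (1 + \<eta>) powr (p + \<alpha>) * d x powr (p + \<alpha>)"
        using d_pos[of x] True \<open>\<eta> > 0\<close> by (intro powr_mult)
      finally have "1 / d x powr (p + \<alpha>) \<le> (1 + \<eta>) powr (p + \<alpha>) / dist x z powr (p + \<alpha>)"
        using d_pos[of x] lower[OF that, of x] True by (intro frac) auto
      from mult_left_mono[OF this, of "\<bar>\<phi> x\<bar> powr p"]
      have "\<bar>\<phi> x\<bar> powr p / d x powr (p + \<alpha>)
          \<le> (1 + \<eta>) powr (p + \<alpha>) * (\<bar>\<phi> x\<bar> powr p / norm (x - z) powr (p + \<alpha>))"
        by (simp add: dist_norm mult.commute)
      note ennreal_leI[OF this, unfolded ennreal_mult''[OF divide_nonneg_nonneg[OF powr_ge_zero powr_ge_zero]]]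
      moreover have "x \<in> \<Omega>" using True K(2) by blast
      ultimately show ?thesis
        using True by simp
    next
      case False
      then show ?thesis using outside(1)[of x] by (auto simp: indicator_def)
    qed
    have G_le: "ennreal (norm (gradient \<phi> x) powr p / norm (x - z) powr \<alpha>) * indicator (C z) x
        \<le> ennreal ((1 + \<eta>) powr \<bar>\<alpha>\<bar>) * (?G x * indicator (C z) x)" if "z \<in> Z" for x z
    proof (cases "x \<in> C z \<and> x \<in> K")
      case True
      have "1 / dist x z powr \<alpha> \<le> (1 + \<eta>) powr \<bar>\<alpha>\<bar> / d x powr \<alpha>"
      \<comment> \<open>The sign of \<alpha> decides which comparison of d with the distance to z is
        used: \<open>lower\<close> for \<alpha> \<ge> 0, \<open>upper\<close> with its factor 1 +
        \<eta> for negative \<alpha>.\<close>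
      proof (cases "\<alpha> \<ge> 0")
        case nonneg: True
        have "d x powr \<alpha> \<le> dist x z powr \<alpha>"
          using lower[OF that] d_pos[of x] True nonneg by (intro powr_mono2) auto
        moreover have "1 \<le> (1 + \<eta>) powr \<alpha>"
          using nonneg \<open>\<eta> > 0\<close> by (simp add: ge_one_powr_ge_zero)
        ultimately show ?thesis
          using d_pos[of x] True nonneg by (intro frac_le) auto
      next
        case neg: False
        have "dist x z powr (- \<alpha>) \<le> ((1 + \<eta>) * d x) powr (- \<alpha>)"
          using upper True neg by (intro powr_mono2) auto
        then show ?thesis
          using neg d_pos[of x] True \<open>\<eta> > 0\<close> by (simp add: powr_mult powr_minus_divide)
      qed
      from mult_left_mono[OF this, of "norm (gradient \<phi> x) powr p"]
      have "norm (gradient \<phi> x) powr p / norm (x - z) powr \<alpha>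
          \<le> (1 + \<eta>) powr \<bar>\<alpha>\<bar> * (norm (gradient \<phi> x) powr p / d x powr \<alpha>)"
        by (simp add: dist_norm mult.commute)
      note ennreal_leI[OF this, unfolded ennreal_mult''[OF divide_nonneg_nonneg[OF powr_ge_zero powr_ge_zero]]]
      moreover have "x \<in> \<Omega>" using True K(2) by blast
      ultimately show ?thesis
        using True by simp
    next
      case False
      then show ?thesis using outside(2)[of x] by (auto simp: indicator_def)
    qed
    \<comment> \<open>A cell may stick out of \<Omega>, but \<phi> is smooth on the whole space and
      vanishes outside K. The estimate therefore runs over the entire cell; \<open>F_le\<close> and
      \<open>G_le\<close> translate it back to \<Omega>.\<close>
    have hardy: "ennreal (\<kappa> powr p) * (\<integral>\<^sup>+x\<in>C z. ennreal (\<bar>\<phi> x\<bar> powr p / norm (x - z) powr (p + \<alpha>)) \<partial>lborel)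
      \<le> (\<integral>\<^sup>+x\<in>C z. ennreal (norm (gradient \<phi> x) powr p / norm (x - z) powr \<alpha>) \<partial>lborel)" if "z \<in> Z" for z
    proof (rule hardy_star_shaped[OF \<phi> _ _ _ p(1) \<kappa>_def \<open>\<kappa> > 0\<close>])
      have "z \<notin> K"
        using that Z(3) K(2) \<Omega>(1) by (auto simp: is_domain_def frontier_def interior_open)
      then show "\<phi> z = 0" by (rule outside)
    qed (auto simp: C_def intro: voronoi_cell_star_shaped sets_voronoi_cell Z(1))
    have "ennreal (\<kappa> powr p) * (\<integral>\<^sup>+x. ?F x \<partial>lborel)
        = ennreal (\<kappa> powr p) * (\<Sum>z\<in>Z. \<integral>\<^sup>+x\<in>C z. ?F x \<partial>lborel)"
      unfolding C_def by (subst nn_integral_voronoi_cells[OF Z(1,2) r]) auto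
    also have "\<dots> \<le> ennreal (\<kappa> powr p) * (\<Sum>z\<in>Z. \<integral>\<^sup>+x. ennreal ((1 + \<eta>) powr (p + \<alpha>)) *
        (ennreal (\<bar>\<phi> x\<bar> powr p / norm (x - z) powr (p + \<alpha>)) * indicator (C z) x) \<partial>lborel)"
      by (intro mult_left_mono sum_mono nn_integral_mono F_le) auto
    also have "\<dots> = (\<Sum>z\<in>Z. ennreal ((1 + \<eta>) powr (p + \<alpha>)) * (ennreal (\<kappa> powr p) *
        (\<integral>\<^sup>+x\<in>C z. ennreal (\<bar>\<phi> x\<bar> powr p / norm (x - z) powr (p + \<alpha>)) \<partial>lborel)))"
      by (simp add: nn_integral_cmult sum_distrib_left mult.left_commute)
    also have "\<dots> \<le> (\<Sum>z\<in>Z. ennreal ((1 + \<eta>) powr (p + \<alpha>)) *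
        (\<integral>\<^sup>+x. ennreal ((1 + \<eta>) powr \<bar>\<alpha>\<bar>) * (?G x * indicator (C z) x) \<partial>lborel))"
      by (intro sum_mono mult_left_mono order_trans[OF hardy] nn_integral_mono G_le) auto
    also have "\<dots> = (\<Sum>z\<in>Z. ennreal ((1 + \<eta>) powr q) * (\<integral>\<^sup>+x\<in>C z. ?G x \<partial>lborel))"
      by (simp add: nn_integral_cmult q_def powr_add[of _ "p + \<alpha>"] ennreal_mult mult.assoc)
    also have "\<dots> = ennreal ((1 + \<eta>) powr q) * (\<integral>\<^sup>+x. ?G x \<partial>lborel)"
      unfolding C_def sum_distrib_left[symmetric]
      by (subst nn_integral_voronoi_cells[OF Z(1,2) r]) auto
    finally show ?thesis .
  qed
  \<comment> \<open>Now \<eta> tends to 0 from the right. The gradient integral is taken finite so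
    that the limit can be computed on reals; the infinite case is trivial.\<close>
  have "ennreal (\<kappa> powr p) * (\<integral>\<^sup>+x. ?F x \<partial>lborel) \<le> (\<integral>\<^sup>+x. ?G x \<partial>lborel)"
  proof (cases "(\<integral>\<^sup>+x. ?G x \<partial>lborel) = top")
    case False
    then obtain R where R: "(\<integral>\<^sup>+x. ?G x \<partial>lborel) = ennreal R" "R \<ge> 0"
      by (cases "\<integral>\<^sup>+x. ?G x \<partial>lborel") auto
    have "((\<lambda>\<eta>. ennreal ((1 + \<eta>) powr q * R)) \<longlongrightarrow> ennreal ((1 + 0) powr q * R)) (at_right 0)"
      by (intro tendsto_intros) auto
    moreover have "\<forall>\<^sub>F \<eta> in at_right 0. ennreal (\<kappa> powr p) * (\<integral>\<^sup>+x. ?F x \<partial>lborel) \<le> ennreal ((1 + \<eta>) powr q * R)"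
      using approx R by (auto simp: eventually_at_filter ennreal_mult)
    ultimately show ?thesis
      using R by (auto intro: tendsto_lowerbound)
  qed simp
  then show "ennreal (((\<alpha> + p - real DIM('a)) / p) powr p) *
      (\<integral>\<^sup>+x\<in>\<Omega>. ennreal (\<bar>\<phi> x\<bar> powr p / bdist \<Omega> x powr (p + \<alpha>)) \<partial>lborel)
      \<le> (\<integral>\<^sup>+x\<in>\<Omega>. ennreal (norm (gradient \<phi> x) powr p / bdist \<Omega> x powr \<alpha>) \<partial>lborel)"
    by (simp add: \<kappa>_def d_def)
qed

subsection \<open>Sharpness on the punctured space\<close>

text \<open>The quotient is written with exponent -1 to fit the \<open>powr\<close> rule of
  \<open>smooth_fun\<close>. Its denominator is positive because every r satisfies r > 1 or r <
  2.\<close>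

definition smooth_step :: "real \<Rightarrow> real" where
  "smooth_step r = flat_exp 0 (r - 1) * (flat_exp 0 (r - 1) + flat_exp 0 (2 - r)) powr (-1)"

lemma smooth_step_denominator_pos: "flat_exp 0 (r - 1) + flat_exp 0 (2 - r) > 0"
  by (auto simp: flat_exp_def intro: add_pos_pos)

lemma smooth_step_simps [simp]: "r \<le> 1 \<Longrightarrow> smooth_step r = 0" "r \<ge> 2 \<Longrightarrow> smooth_step r = 1"
  by (auto simp: smooth_step_def flat_exp_def powr_minus)

lemma smooth_step_bounds: "0 \<le> smooth_step r" "smooth_step r \<le> 1"
  using smooth_step_denominator_pos[of r]
  by (auto simp: smooth_step_def flat_exp_def powr_minus divide_simps)

lemma smooth_fun_ident: "smooth_fun (\<lambda>r::real. r)"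
  using smooth_fun.inner[of "1::real"] by simp

lemma smooth_fun_smooth_step: "smooth_fun smooth_step"
  unfolding smooth_step_def
  by (intro smooth_fun.intros smooth_fun_diff smooth_fun_ident smooth_step_denominator_pos)

lemma smooth_fun_real_derivative:
  fixes f :: "real \<Rightarrow> real"
  assumes "smooth_fun f"
  shows "(f has_real_derivative deriv f x) (at x)" "continuous_on A (deriv f)"
proof -
  obtain f' where f': "\<And>x. (f has_derivative f' x) (at x)" "\<And>b. smooth_fun (\<lambda>x. f' x b)"
    using smooth_fun_derivative[OF assms] by blast
  have *: "(f has_real_derivative f' x 1) (at x)" for x
    using f'(1)[of x] by (metis has_derivative_imp_has_field_derivative mult.commute mult_1_right
        has_derivative_linear linear_scale real_scaleR_def)
  then have eq: "deriv f = (\<lambda>x. f' x 1)"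
    by (auto intro: DERIV_imp_deriv)
  with * show "(f has_real_derivative deriv f x) (at x)" by simp
  obtain g' where "\<And>x. ((\<lambda>x. f' x 1) has_derivative g' x) (at x)"
    using smooth_fun_derivative[OF f'(2)[of 1]] by blast
  then show "continuous_on A (deriv f)"
    unfolding eq by (intro continuous_at_imp_continuous_on ballI has_derivative_continuous)
qed

section \<open>Truncated powers of the squared norm\<close>

lemma gradient_radial:
  fixes F :: "real \<Rightarrow> real"
  assumes "(F has_real_derivative D) (at (x \<bullet> x))"
  shows "gradient (\<lambda>x. F (x \<bullet> x)) x = (2 * D) *\<^sub>R x"
proof (rule gradient_eqI)
  have "((\<lambda>x. x \<bullet> x) has_derivative (\<lambda>v. x \<bullet> v + v \<bullet> x)) (at x)"
    by (auto intro!: derivative_eq_intros)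
  from has_derivative_compose[OF this has_field_derivative_imp_has_derivative[OF assms]]
  have "((\<lambda>x. F (x \<bullet> x)) has_derivative (\<lambda>v. D * (x \<bullet> v + v \<bullet> x))) (at x)" .
  also have "(\<lambda>v. D * (x \<bullet> v + v \<bullet> x)) = (\<bullet>) ((2 * D) *\<^sub>R x)"
    by (auto simp: inner_commute)
  finally show "((\<lambda>x. F (x \<bullet> x)) has_derivative (\<bullet>) ((2 * D) *\<^sub>R x)) (at x)" .
qed

lemma norm_powr_eq_inner: "norm x powr a = (x \<bullet> x) powr (a / 2)"
  by (cases "x = 0") (simp_all add: norm_eq_sqrt_inner powr_half_sqrt[symmetric] powr_powr)

lemma bounded_abs_on_1_2:
  fixes f :: "real \<Rightarrow> real"
  assumes "continuous_on {1..2} f"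
  obtains M where "M \<ge> 0" "\<And>t. 1 \<le> t \<Longrightarrow> t \<le> 2 \<Longrightarrow> \<bar>f t\<bar> \<le> M"
proof -
  have "bounded (f ` {1..2})"
    by (intro compact_imp_bounded compact_continuous_image assms) auto
  then obtain M where M: "\<forall>t\<in>{1..2}. \<bar>f t\<bar> \<le> M"
    by (auto simp: bounded_iff)
  show ?thesis
    by (rule that[of "\<bar>M\<bar>"]) (use M in force)+
qed

lemma deriv_smooth_step_eq_0:
  assumes "t < 1 \<or> t > 2"
  shows "deriv smooth_step t = 0"
proof (rule DERIV_imp_deriv)
  consider "t < 1" | "t > 2" using assms by blast
  then show "(smooth_step has_real_derivative 0) (at t)"
  proof cases
    case 1
    have "((\<lambda>_. 0) has_real_derivative 0) (at t)" by simp
    then show ?thesis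
      by (rule has_field_derivative_transform_within_open[of _ _ _ "{..<1}"]) (use 1 in auto)
  next
    case 2
    have "((\<lambda>_. 1) has_real_derivative 0) (at t)" by simp
    then show ?thesis
      by (rule has_field_derivative_transform_within_open[of _ _ _ "{2<..}"]) (use 2 in auto)
  qed
qed

text \<open>The power \<open>r\<^bsup>\<kappa>/2\<^esup>\<close>, cut off below \<open>1\<close>; its base \<open>1 + (r - 1) smooth_step r\<close> is at least \<open>1\<close>
  everywhere and equals \<open>r\<close> for \<open>r \<ge> 2\<close>.\<close>

definition cut_powr :: "real \<Rightarrow> real \<Rightarrow> real" where
  "cut_powr \<kappa> r = (1 + (r - 1) * smooth_step r) powr (\<kappa> / 2) * smooth_step r"

lemma cut_powr_simps [simp]: "r \<le> 1 \<Longrightarrow> cut_powr \<kappa> r = 0" "r \<ge> 2 \<Longrightarrow> cut_powr \<kappa> r = r powr (\<kappa> / 2)"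
  by (auto simp: cut_powr_def)

lemma smooth_fun_cut_powr: "smooth_fun (cut_powr \<kappa>)"
proof -
  have "1 + (r - 1) * smooth_step r > 0" for r
  proof (cases "r \<le> 1")
    case False
    then have "(r - 1) * smooth_step r \<ge> 0"
      using smooth_step_bounds by simp
    then show ?thesis by simp
  qed simp
  then show ?thesis
    unfolding cut_powr_def
    by (intro smooth_fun.intros smooth_fun_diff smooth_fun_ident smooth_fun_smooth_step)
qed

lemma deriv_cut_powr:
  assumes "r > 2"
  shows "deriv (cut_powr \<kappa>) r = \<kappa> / 2 * r powr (\<kappa> / 2 - 1)"
proof (rule DERIV_imp_deriv)
  have "((\<lambda>r. r powr (\<kappa> / 2)) has_real_derivative \<kappa> / 2 * r powr (\<kappa> / 2 - 1)) (at r)"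
    using assms by (intro has_real_derivative_powr) auto
  then show "(cut_powr \<kappa> has_real_derivative \<kappa> / 2 * r powr (\<kappa> / 2 - 1)) (at r)"
    by (rule has_field_derivative_transform_within_open[of _ _ _ "{2<..}"]) (use assms in auto)
qed

text \<open>The argument stands for \<open>x \<bullet> x\<close>, which unlike the norm is smooth at
  the origin; hence the halved exponent. The second factor switches off between B and 2 B.\<close>

definition trunc_powr :: "real \<Rightarrow> real \<Rightarrow> real \<Rightarrow> real" where
  "trunc_powr \<kappa> B r = cut_powr \<kappa> r * (1 - smooth_step (r / B))"

definition trunc_powr' :: "real \<Rightarrow> real \<Rightarrow> real \<Rightarrow> real" where
  "trunc_powr' \<kappa> B r = deriv (cut_powr \<kappa>) r * (1 - smooth_step (r / B))
     - cut_powr \<kappa> r * (deriv smooth_step (r / B) / B)"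

lemma smooth_fun_trunc_powr:
  shows "smooth_fun (trunc_powr \<kappa> B)"
proof -
  have "smooth_fun (\<lambda>r. smooth_step (r * (1 / B)))"
    by (intro smooth_fun_compose[OF smooth_fun_smooth_step] smooth_fun.intros smooth_fun_ident)
  then show ?thesis
    unfolding trunc_powr_def
    by (intro smooth_fun.intros smooth_fun_diff smooth_fun_cut_powr) auto
qed

lemma trunc_powr_has_derivative:
  assumes "B > 0"
  shows "(trunc_powr \<kappa> B has_real_derivative trunc_powr' \<kappa> B r) (at r)"
proof -
  have "((\<lambda>r. smooth_step (r / B)) has_real_derivative deriv smooth_step (r / B) * (1 / B)) (at r)"
    by (rule DERIV_chain2[OF smooth_fun_real_derivative(1)[OF smooth_fun_smooth_step]])
      (use assms in \<open>auto intro!: derivative_eq_intros\<close>)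
  then show ?thesis
    unfolding trunc_powr_def trunc_powr'_def
    by (auto intro!: derivative_eq_intros smooth_fun_real_derivative(1)[OF smooth_fun_cut_powr])
qed

lemma trunc_powr_eq:
  assumes "B \<ge> 4"
  shows "r \<le> 1 \<Longrightarrow> trunc_powr \<kappa> B r = 0"
    and "2 \<le> r \<Longrightarrow> r \<le> B \<Longrightarrow> trunc_powr \<kappa> B r = r powr (\<kappa> / 2)"
    and "2 * B \<le> r \<Longrightarrow> trunc_powr \<kappa> B r = 0"
  using assms by (auto simp: trunc_powr_def divide_simps)

text \<open>What matters is that C does not depend on B. On [1, 2] the outer cutoff is inactive, and
  a continuous function on a compact interval is bounded. On [B, 2 B] the chain rule factor 1 / B is
  at most 2 / r, which restores the power \<kappa> / 2 - 1.\<close>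

lemma trunc_powr'_bounds:
  obtains C where "C \<ge> 0"
    "\<And>B r. B \<ge> 4 \<Longrightarrow> 1 \<le> r \<and> r \<le> 2 \<or> B \<le> r \<and> r \<le> 2 * B \<Longrightarrow> \<bar>trunc_powr' \<kappa> B r\<bar> \<le> C * r powr (\<kappa> / 2 - 1)"
proof -
  have "continuous_on {1..2} (\<lambda>r. deriv (cut_powr \<kappa>) r / r powr (\<kappa> / 2 - 1))"
    by (intro continuous_intros smooth_fun_real_derivative(2) smooth_fun_cut_powr) auto
  then obtain M1 where M1: "M1 \<ge> 0" "\<And>r. 1 \<le> r \<Longrightarrow> r \<le> 2 \<Longrightarrow> \<bar>deriv (cut_powr \<kappa>) r / r powr (\<kappa> / 2 - 1)\<bar> \<le> M1"
    by (rule bounded_abs_on_1_2) blast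
  obtain M2 where M2: "M2 \<ge> 0" "\<And>t. 1 \<le> t \<Longrightarrow> t \<le> 2 \<Longrightarrow> \<bar>deriv smooth_step t\<bar> \<le> M2"
    by (rule bounded_abs_on_1_2[OF smooth_fun_real_derivative(2)[OF smooth_fun_smooth_step]]) blast
  \<comment> \<open>\<open>M1\<close> covers the inner shell. In the outer shell
    \<bar>\<kappa>\<bar> / 2 comes from differentiating the power and 2 \<open>M2\<close> from
    differentiating the cutoff.\<close>
  define C where "C = M1 + \<bar>\<kappa>\<bar> / 2 + 2 * M2"
  show ?thesis
  proof (rule that[of C])
    show "C \<ge> 0" using M1(1) M2(1) by (simp add: C_def)
    fix B r :: real
    assume "B \<ge> 4" and "1 \<le> r \<and> r \<le> 2 \<or> B \<le> r \<and> r \<le> 2 * B"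
    then consider "1 \<le> r" "r \<le> 2" | "B \<le> r" "r \<le> 2 * B" by blast
    then show "\<bar>trunc_powr' \<kappa> B r\<bar> \<le> C * r powr (\<kappa> / 2 - 1)"
    proof cases
      case 1
      then have "r / B < 1" using \<open>B \<ge> 4\<close> by (simp add: divide_simps)
      then have "trunc_powr' \<kappa> B r = deriv (cut_powr \<kappa>) r"
        by (simp add: trunc_powr'_def deriv_smooth_step_eq_0)
      moreover have "\<bar>deriv (cut_powr \<kappa>) r\<bar> \<le> M1 * r powr (\<kappa> / 2 - 1)"
        using M1(2)[of r] 1 by (simp add: abs_divide divide_simps)
      moreover have "\<dots> \<le> C * r powr (\<kappa> / 2 - 1)"
        using M2(1) by (intro mult_right_mono) (auto simp: C_def)
      ultimately show ?thesis by simp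
    next
      case 2
      have r: "r > 2" using 2 \<open>B \<ge> 4\<close> by simp
      have "\<bar>deriv smooth_step (r / B)\<bar> \<le> M2"
        using 2 \<open>B \<ge> 4\<close> by (intro M2) (auto simp: divide_simps)
      then have "\<bar>deriv smooth_step (r / B)\<bar> / B \<le> M2 / (r / 2)"
        using 2 \<open>B \<ge> 4\<close> by (intro frac_le) auto
      then have "r powr (\<kappa> / 2) * (\<bar>deriv smooth_step (r / B)\<bar> / B) \<le> r powr (\<kappa> / 2) * (M2 / (r / 2))"
        by (intro mult_left_mono) auto
      also have "\<dots> = 2 * M2 * r powr (\<kappa> / 2 - 1)"
        using r by (simp add: powr_diff)
      finally have *: "\<bar>cut_powr \<kappa> r * (deriv smooth_step (r / B) / B)\<bar> \<le> 2 * M2 * r powr (\<kappa> / 2 - 1)"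
        using r \<open>B \<ge> 4\<close> by (simp add: abs_mult)
      have "\<bar>deriv (cut_powr \<kappa>) r * (1 - smooth_step (r / B))\<bar> \<le> (\<bar>\<kappa>\<bar> / 2 * r powr (\<kappa> / 2 - 1)) * 1"
        unfolding abs_mult
        by (intro mult_mono) (use r smooth_step_bounds[of "r / B"] in \<open>auto simp: deriv_cut_powr abs_mult\<close>)
      with * have "\<bar>trunc_powr' \<kappa> B r\<bar> \<le> (\<bar>\<kappa>\<bar> / 2 + 2 * M2) * r powr (\<kappa> / 2 - 1)"
        unfolding trunc_powr'_def distrib_right mult_1_right
        by (intro order_trans[OF abs_triangle_ineq4 add_mono])
      also have "\<dots> \<le> C * r powr (\<kappa> / 2 - 1)"
        using M1(1) by (intro mult_right_mono) (auto simp: C_def)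
      finally show ?thesis .
    qed
  qed
qed

lemma trunc_powr'_eq:
  assumes "B \<ge> 4"
  shows "r < 1 \<or> r > 2 * B \<Longrightarrow> trunc_powr' \<kappa> B r = 0"
    and "2 < r \<Longrightarrow> r < B \<Longrightarrow> trunc_powr' \<kappa> B r = \<kappa> / 2 * r powr (\<kappa> / 2 - 1)"
proof -
  show "trunc_powr' \<kappa> B r = \<kappa> / 2 * r powr (\<kappa> / 2 - 1)" if "2 < r" "r < B"
    using that assms by (simp add: trunc_powr'_def deriv_cut_powr deriv_smooth_step_eq_0)
  show "trunc_powr' \<kappa> B r = 0" if "r < 1 \<or> r > 2 * B"
  proof (rule DERIV_unique[OF trunc_powr_has_derivative])
    have "((\<lambda>_. 0) has_real_derivative 0) (at r)" by simp
    then show "(trunc_powr \<kappa> B has_real_derivative 0) (at r)"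
      by (rule has_field_derivative_transform_within_open[of _ _ _ "{..<1} \<union> {2 * B<..}"])
        (use that assms in \<open>auto simp: trunc_powr_eq\<close>)
  qed (use assms in simp)
qed

lemma trunc_powr_test_function:
  assumes "B \<ge> 4"
  shows "(\<lambda>x. trunc_powr \<kappa> B (x \<bullet> x)) \<in> test_functions (- {0 :: 'a::euclidean_space})"
proof -
  let ?S = "{x::'a. trunc_powr \<kappa> B (x \<bullet> x) \<noteq> 0}" and ?A = "{x::'a. 1 \<le> x \<bullet> x} \<inter> {x. x \<bullet> x \<le> 2 * B}"
  have "closed ?A"
    by (intro closed_Int closed_Collect_le continuous_intros)
  moreover have "?S \<subseteq> ?A"
    using trunc_powr_eq[OF assms] by (auto simp: not_le dest: less_imp_le) (metis linorder_not_le less_imp_le)+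
  ultimately have "closure ?S \<subseteq> ?A"
    by (rule closure_minimal[rotated])
  moreover have "bounded ?A"
    by (rule boundedI[of _ "sqrt (2 * B)"]) (auto simp: norm_eq_sqrt_inner)
  ultimately have "compact (closure ?S)" "closure ?S \<subseteq> - {0}"
    by (auto simp: compact_eq_bounded_closed intro: bounded_subset)
  moreover have "smooth_fun (\<lambda>x::'a. x \<bullet> x)"
    using smooth_fun_inner_self[of "0::'a"] by simp
  then have "C_infinity (\<lambda>x::'a. trunc_powr \<kappa> B (x \<bullet> x))"
    by (intro smooth_fun_imp_C_infinity smooth_fun_compose[OF smooth_fun_trunc_powr])
  ultimately show ?thesis
    by (simp add: test_functions_def)
qed

section \<open>The dilation-invariant measure, which is dr/r times surface measure in polar
  coordinates\<close>

definition log_measure :: "'a::euclidean_space measure" where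
  "log_measure = density lborel (\<lambda>x. ennreal (norm x powr - real DIM('a)))"

lemma sets_log_measure [measurable_cong, simp]: "sets log_measure = sets borel"
  by (simp add: log_measure_def)

definition shell :: "real set \<Rightarrow> 'a::euclidean_space set" where
  "shell S = {x. x \<bullet> x \<in> S}"

lemma sets_shell [measurable]: "S \<in> sets borel \<Longrightarrow> shell S \<in> sets (borel :: 'a::euclidean_space measure)"
  using measurable_sets_borel[of "\<lambda>x::'a. x \<bullet> x" borel S] by (simp add: shell_def vimage_def)

lemma emeasure_log_measure:
  "A \<in> sets borel \<Longrightarrow> emeasure log_measure (A :: 'a::euclidean_space set)
    = (\<integral>\<^sup>+x\<in>A. ennreal (norm x powr - real DIM('a)) \<partial>lborel)"
  by (simp add: log_measure_def emeasure_density)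

text \<open>Shells are indexed by the squared norm, so the dilation factor is sqrt c. Its Jacobian
  cancels against the change of the density.\<close>

lemma emeasure_log_measure_scale:
  assumes [measurable]: "S \<in> sets borel" and "c > 0"
  shows "emeasure log_measure (shell ((\<lambda>r. r / c) -` S) :: 'a::euclidean_space set)
    = emeasure log_measure (shell S :: 'a set)"
proof -
  let ?n = "DIM('a)"
  have [measurable]: "(\<lambda>r. r / c) -` S \<in> sets borel"
    using measurable_sets_borel[of "\<lambda>r. r / c" borel S] assms by simp
  have sq: "(sqrt c *\<^sub>R x) \<bullet> (sqrt c *\<^sub>R x) / c = x \<bullet> x" for x :: 'a
    using assms(2) by (simp add: field_simps)
  have "emeasure log_measure (shell ((\<lambda>r. r / c) -` S) :: 'a set)
      = (\<integral>\<^sup>+x. ennreal (norm x powr - real ?n) * indicator (shell ((\<lambda>r. r / c) -` S)) (x :: 'a) \<partial>lborel)"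
    by (rule emeasure_log_measure) measurable
  also have "\<dots> = ennreal (\<bar>sqrt c\<bar> ^ ?n) * (\<integral>\<^sup>+x. ennreal (norm (0 + sqrt c *\<^sub>R x) powr - real ?n) *
      indicator (shell ((\<lambda>r. r / c) -` S)) (0 + sqrt c *\<^sub>R x :: 'a) \<partial>lborel)"
    by (rule nn_integral_lborel_affine) (use assms(2) in auto)
  also have "\<dots> = ennreal (sqrt c ^ ?n) * (\<integral>\<^sup>+x. ennreal (sqrt c powr - real ?n) *
      (ennreal (norm x powr - real ?n) * indicator (shell S) (x :: 'a)) \<partial>lborel)"
    using assms(2) sq by (simp add: powr_mult ennreal_mult mult.assoc shell_def indicator_def)
  also have "\<dots> = ennreal (sqrt c ^ ?n * sqrt c powr - real ?n) * emeasure log_measure (shell S :: 'a set)"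
    using assms(2) by (simp add: nn_integral_cmult emeasure_log_measure ennreal_mult mult.assoc)
  also have "sqrt c ^ ?n * sqrt c powr - real ?n = 1"
    using assms(2) by (simp flip: powr_realpow powr_add)
  finally show ?thesis by simp
qed

lemma emeasure_log_measure_shell_finite:
  assumes "S \<in> sets borel" "S \<subseteq> {1..b}"
  shows "emeasure log_measure (shell S :: 'a::euclidean_space set) < top"
proof -
  have weight: "norm x powr - real DIM('a) \<le> 1" and norm: "norm x \<le> sqrt b" if "x \<in> shell S" for x :: 'a
  proof -
    have "1 \<le> x \<bullet> x" "x \<bullet> x \<le> b"
      using that assms(2) by (auto simp: shell_def)
    then show "norm x powr - real DIM('a) \<le> 1" "norm x \<le> sqrt b"
      using ge_one_powr_ge_zero[of "norm x" "real DIM('a)"]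
      by (auto simp: norm_eq_sqrt_inner powr_minus inverse_le_1_iff)
  qed
  have "emeasure log_measure (shell S :: 'a set)
      = (\<integral>\<^sup>+x\<in>shell S. ennreal (norm (x::'a) powr - real DIM('a)) \<partial>lborel)"
    using assms(1) by (intro emeasure_log_measure sets_shell)
  also have "\<dots> \<le> (\<integral>\<^sup>+x. indicator (cball (0::'a) (sqrt b)) x \<partial>lborel)"
    using weight norm by (intro nn_integral_mono) (auto simp: indicator_def)
  also have "\<dots> = emeasure lborel (cball (0::'a) (sqrt b))" by simp
  also have "\<dots> < top" using emeasure_lborel_cball_finite by (simp add: less_top)
  finally show ?thesis .
qed

lemma AE_avoids_open_imp_empty:
  fixes U :: "'a::euclidean_space set"
  assumes "open U" and "AE x in lborel. x \<notin> U"
  shows "U = {}"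
proof -
  have "U \<in> null_sets lborel"
    using assms by (simp add: AE_iff_null_sets)
  then have "negligible U"
    using assms(1) by (simp add: negligible_iff_null_sets null_sets_completion_iff)
  with assms(1) show ?thesis
    using open_not_negligible by blast
qed

lemma emeasure_log_measure_shell_pos:
  "emeasure log_measure (shell {1<..<2} :: 'a::euclidean_space set) > 0"
proof -
  let ?A = "shell {1<..<2} :: 'a set"
  obtain b :: 'a where "b \<in> Basis" using nonempty_Basis by blast
  then have "sqrt (3/2) *\<^sub>R b \<in> ?A" by (simp add: shell_def inner_Basis)
  moreover have "open ?A"
    unfolding shell_def greaterThanLessThan_def
    by (auto simp: open_Collect_conj open_Collect_less continuous_intros)
  ultimately have not_AE: "\<not> (AE x in lborel. x \<notin> ?A)"
    using AE_avoids_open_imp_empty by blast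
  have "emeasure log_measure ?A \<noteq> 0"
  proof
    assume "emeasure log_measure ?A = 0"
    then have "AE x in lborel. ennreal (norm x powr - real DIM('a)) * indicator ?A x = 0"
      by (simp add: emeasure_log_measure nn_integral_0_iff_AE)
    then have "AE x in lborel. x \<notin> ?A"
      by eventually_elim (auto simp: indicator_def shell_def)
    with not_AE show False by blast
  qed
  then show ?thesis by (simp add: zero_less_iff_neq_zero)
qed

text \<open>The interval from 2 to 2^(N + 1) contains the N disjoint dyadic intervals from 2^k to
  2^(k + 1), and dilation by powers of 2 gives each of their shells the same mass.\<close>

lemma emeasure_log_measure_unbounded:
  "of_nat N * emeasure log_measure (shell {1<..<2} :: 'a::euclidean_space set)
    \<le> emeasure log_measure (shell {2<..<2 ^ (N + 1)} :: 'a set)"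
proof (induction N)
  case (Suc N)
  let ?b = "2 ^ (N + 1) :: real"
  have "(\<lambda>r. r / ?b) -` {1<..<2} = {?b<..<2 ^ (Suc N + 1)}"
    by (auto simp: field_simps)
  then have *: "emeasure log_measure (shell {1<..<2} :: 'a set)
      = emeasure log_measure (shell {?b<..<2 ^ (Suc N + 1)} :: 'a set)"
    using emeasure_log_measure_scale[of "{1<..<2}" ?b, where 'a = 'a] by simp
  have "of_nat (Suc N) * emeasure log_measure (shell {1<..<2} :: 'a set)
      \<le> emeasure log_measure (shell {2<..<?b} :: 'a set) + emeasure log_measure (shell {?b<..<2 ^ (Suc N + 1)} :: 'a set)"
    using Suc unfolding *[symmetric] by (simp add: distrib_right add.commute add_left_mono)
  also have "\<dots> = emeasure log_measure (shell {2<..<?b} \<union> shell {?b<..<2 ^ (Suc N + 1)} :: 'a set)"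
    by (rule plus_emeasure) (auto simp: shell_def[of "_ :: real set"] intro!: sets_shell[unfolded shell_def])
  also have "\<dots> \<le> emeasure log_measure (shell {2<..<2 ^ (Suc N + 1)} :: 'a set)"
  proof (rule emeasure_mono)
    have "shell {a<..<b} \<union> shell {b<..<c} \<subseteq> (shell {a<..<c} :: 'a set)" if "a \<le> b" "b \<le> c" for a b c
      using that by (auto simp: shell_def)
    then show "shell {2<..<?b} \<union> shell {?b<..<2 ^ (Suc N + 1)} \<subseteq> (shell {2<..<2 ^ (Suc N + 1)} :: 'a set)"
      by simp
  qed simp
  finally show ?case .
qed simp

section \<open>The Hardy inequality on the punctured space\<close>

lemma bdist_punctured: "bdist (- {0}) (x :: 'a::euclidean_space) = norm x"
proof -
  have "frontier (- {0 :: 'a}) = {0}"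
    by (simp add: frontier_def closure_complement interior_complement)
  then show ?thesis by (simp add: bdist_def)
qed

text \<open>The dimension enters through connectedness: a punctured line falls apart.\<close>

lemma is_domain_punctured:
  "DIM('a) \<ge> 2 \<Longrightarrow> is_domain (- {0 :: 'a::euclidean_space})"
proof -
  assume *: "DIM('a) \<ge> 2"
  obtain b :: 'a where "b \<in> Basis" using nonempty_Basis by blast
  then have "b \<in> - {0}" by auto
  with connected_punctured_universe[OF *, of 0] show ?thesis
    by (auto simp: is_domain_def)
qed

lemma hardy_punctured_sharp:
  assumes p: "1 < p" and \<kappa>: "\<kappa> = (\<alpha> + p - real DIM('a)) / p" "\<kappa> > 0"
    and hardy: "weighted_hardy_ineq p \<alpha> (- {0 :: 'a::euclidean_space}) c"
  shows "c \<le> \<kappa> powr p"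
proof (rule ccontr)
  assume "\<not> c \<le> \<kappa> powr p"
  then have "c > \<kappa> powr p" by simp
  \<comment> \<open>Positivity of c ensures that \<open>ennreal c\<close> represents c instead of
    collapsing to 0.\<close>
  with le_less_trans[OF powr_ge_zero this] have c: "c > \<kappa> powr p" "c > 0" by auto
  let ?n = "real DIM('a)" and ?\<mu> = "log_measure :: 'a measure"
  obtain C where C: "C \<ge> 0" "\<And>B r. B \<ge> 4 \<Longrightarrow> 1 \<le> r \<and> r \<le> 2 \<or> B \<le> r \<and> r \<le> 2 * B \<Longrightarrow>
      \<bar>trunc_powr' \<kappa> B r\<bar> \<le> C * r powr (\<kappa> / 2 - 1)"
    by (rule trunc_powr'_bounds[of \<kappa>]) blast
  \<comment> \<open>On the transition shells the gradient has norm at most 2 C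
    \<bar>x\<bar>^(\<kappa> - 1), so D bounds the gradient integrand relative to
    \<bar>x\<bar>^(-n).\<close>
  define D where "D = (2 * C) powr p"
  have "D \<ge> 0" by (simp add: D_def)
  have finite_shell: "emeasure ?\<mu> (shell S) = ennreal (measure ?\<mu> (shell S))"
    if "S \<in> sets borel" "S \<subseteq> {1..b}" for S b
    using emeasure_log_measure_shell_finite[OF that, where 'a = 'a]
    by (intro emeasure_eq_ennreal_measure) auto
  define m where "m = measure ?\<mu> (shell {1..2})"
  have m: "emeasure ?\<mu> (shell {1..2}) = ennreal m"
    unfolding m_def by (rule finite_shell[of _ 2]) auto
  have exponent: "(\<kappa> - 1) * p - \<alpha> = - ?n"
    using p unfolding \<kappa>(1) by (simp add: field_simps)
  \<comment> \<open>T is the mass of the bulk shell. Only the bulk is kept on the function side,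
    whereas the gradient side also pays for two transition shells of mass m each, whatever B
    is.\<close>
  have main: "c * T \<le> \<kappa> powr p * T + D * (2 * m)"
    if "B \<ge> 4" and T: "emeasure ?\<mu> (shell {2<..<B}) = ennreal T" "T \<ge> 0" for B T
  proof -
    define \<phi> where "\<phi> x = trunc_powr \<kappa> B (x \<bullet> x)" for x :: 'a
    have B: "B > 0" using that by simp
    have grad: "norm (gradient \<phi> x) = 2 * \<bar>trunc_powr' \<kappa> B (x \<bullet> x)\<bar> * norm x" for x
      unfolding \<phi>_def gradient_radial[OF trunc_powr_has_derivative[OF B]] by (simp add: abs_mult)
    have power: "(2 * (K * (x \<bullet> x) powr (\<kappa> / 2 - 1)) * norm x) powr p / norm x powr \<alpha>
        = (2 * K) powr p * norm x powr - ?n" if "x \<noteq> 0" "K \<ge> 0" for K and x :: 'a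
    proof -
      have "(x \<bullet> x) powr (\<kappa> / 2 - 1) = norm x powr (\<kappa> - 2)"
        by (simp add: norm_powr_eq_inner diff_divide_distrib)
      moreover have "norm x powr (\<kappa> - 2) * norm x = norm x powr (\<kappa> - 1)"
        using that by (simp add: powr_diff powr_numeral power2_eq_square)
      ultimately have "(2 * (K * (x \<bullet> x) powr (\<kappa> / 2 - 1)) * norm x) = 2 * K * norm x powr (\<kappa> - 1)"
        by (simp add: mult.assoc)
      then have "(2 * (K * (x \<bullet> x) powr (\<kappa> / 2 - 1)) * norm x) powr p = (2 * K) powr p * norm x powr ((\<kappa> - 1) * p)"
        using that by (simp only: powr_mult powr_powr)
      then show ?thesis
        unfolding exponent[symmetric] by (simp add: powr_diff)
    qed
    have "ennreal (c * T) = ennreal c * emeasure ?\<mu> (shell {2<..<B})"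
      using T c by (simp add: ennreal_mult)
    also have "\<dots> = ennreal c * (\<integral>\<^sup>+x\<in>shell {2<..<B}. ennreal (norm (x::'a) powr - ?n) \<partial>lborel)"
      by (subst emeasure_log_measure) auto
    also have "\<dots> \<le> ennreal c * (\<integral>\<^sup>+x\<in>- {0}. ennreal (\<bar>\<phi> x\<bar> powr p / bdist (- {0}) x powr (p + \<alpha>)) \<partial>lborel)"
    proof (intro mult_left_mono nn_integral_mono)
      fix x :: 'a
      have "\<bar>\<phi> x\<bar> powr p / norm x powr (p + \<alpha>) = norm x powr - ?n" if "2 < x \<bullet> x" "x \<bullet> x < B"
      proof -
        have "\<phi> x = norm x powr \<kappa>"
          using that \<open>B \<ge> 4\<close> by (simp add: \<phi>_def trunc_powr_eq norm_powr_eq_inner)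
        moreover have "\<kappa> * p - (p + \<alpha>) = - ?n" using exponent by (simp add: algebra_simps)
        ultimately show ?thesis
          by (simp add: powr_powr flip: powr_diff)
      qed
      then show "ennreal (norm x powr - ?n) * indicator (shell {2<..<B}) x
          \<le> ennreal (\<bar>\<phi> x\<bar> powr p / bdist (- {0}) x powr (p + \<alpha>)) * indicator (- {0}) x"
        by (auto simp: shell_def indicator_def bdist_punctured)
    qed auto
    also have "\<dots> \<le> (\<integral>\<^sup>+x\<in>- {0}. ennreal (norm (gradient \<phi> x) powr p / bdist (- {0}) x powr \<alpha>) \<partial>lborel)"
    proof -
      have "\<phi> \<in> test_functions (- {0})"
        unfolding \<phi>_def by (rule trunc_powr_test_function[OF \<open>B \<ge> 4\<close>])
      with hardy[unfolded weighted_hardy_ineq_def] show ?thesis by (rule bspec)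
    qed
    also have "\<dots> \<le> (\<integral>\<^sup>+x. ennreal (\<kappa> powr p) * (ennreal (norm (x::'a) powr - ?n) * indicator (shell {2<..<B}) x)
        + ennreal D * (ennreal (norm x powr - ?n) * indicator (shell {1..2}) x)
        + ennreal D * (ennreal (norm x powr - ?n) * indicator (shell {B..2 * B}) x) \<partial>lborel)"
    proof (rule nn_integral_mono)
      fix x :: 'a
      let ?w = "ennreal (norm x powr - ?n)" and ?l = "ennreal (norm (gradient \<phi> x) powr p / norm x powr \<alpha>)"
      \<comment> \<open>Three zones: the integrand vanishes, the gradient is an exact power, or it
        is merely bounded through C. The closed transition shells absorb the boundary
        spheres.\<close>
      consider "x = 0 \<or> x \<bullet> x < 1 \<or> x \<bullet> x > 2 * B" | "2 < x \<bullet> x" "x \<bullet> x < B"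
        | "x \<noteq> 0" "1 \<le> x \<bullet> x \<and> x \<bullet> x \<le> 2 \<or> B \<le> x \<bullet> x \<and> x \<bullet> x \<le> 2 * B" by linarith
      then have "?l * indicator (- {0}) x
          \<le> ennreal (\<kappa> powr p) * (?w * indicator (shell {2<..<B}) x)
        + ennreal D * (?w * indicator (shell {1..2} \<union> shell {B..2 * B}) x)"
      proof cases
        case 1
        then have "gradient \<phi> x = 0 \<or> x = 0"
          using grad[of x] trunc_powr'_eq(1)[OF \<open>B \<ge> 4\<close>, of "x \<bullet> x" \<kappa>] by auto
        then show ?thesis by auto
      next
        case 2
        then have "x \<noteq> 0" by auto
        have "norm (gradient \<phi> x) = 2 * (\<kappa> / 2 * (x \<bullet> x) powr (\<kappa> / 2 - 1)) * norm x"
          using 2 \<kappa>(2) unfolding grad trunc_powr'_eq(2)[OF \<open>B \<ge> 4\<close> 2] by simp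
        then have "norm (gradient \<phi> x) powr p / norm x powr \<alpha> = \<kappa> powr p * norm x powr - ?n"
          using power[OF \<open>x \<noteq> 0\<close>, of "\<kappa> / 2"] \<kappa>(2) by simp
        with 2 show ?thesis by (simp add: shell_def indicator_def ennreal_mult)
      next
        case 3
        have "norm (gradient \<phi> x) \<le> 2 * (C * (x \<bullet> x) powr (\<kappa> / 2 - 1)) * norm x"
          unfolding grad using C(2)[OF \<open>B \<ge> 4\<close> 3(2)] by (intro mult_right_mono) auto
        then have "norm (gradient \<phi> x) powr p / norm x powr \<alpha>
          \<le> (2 * (C * (x \<bullet> x) powr (\<kappa> / 2 - 1)) * norm x) powr p / norm x powr \<alpha>"
          using p by (intro divide_right_mono powr_mono2) auto
        also have "\<dots> = D * norm x powr - ?n"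
          unfolding D_def by (rule power) (use 3 C in auto)
        finally have "?l \<le> ennreal D * ?w"
          using \<open>D \<ge> 0\<close> by (subst ennreal_mult[symmetric]) (auto intro: ennreal_leI)
        also have "\<dots> = ennreal D * (?w * indicator (shell {1..2} \<union> shell {B..2 * B}) x)"
          using 3 by (simp add: shell_def indicator_def)
        finally show ?thesis
          by (auto simp: indicator_def intro: order_trans add_increasing)
      qed
      also have "\<dots> \<le> ennreal (\<kappa> powr p) * (?w * indicator (shell {2<..<B}) x)
        + ennreal D * (?w * indicator (shell {1..2}) x) + ennreal D * (?w * indicator (shell {B..2 * B}) x)"
        by (auto simp: indicator_def)
      finally show "ennreal (norm (gradient \<phi> x) powr p / bdist (- {0}) x powr \<alpha>) * indicator (- {0}) x \<le> \<dots>"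
        by (simp add: bdist_punctured)
    qed
    also have "\<dots> = ennreal (\<kappa> powr p) * emeasure ?\<mu> (shell {2<..<B}) + ennreal D * emeasure ?\<mu> (shell {1..2})
        + ennreal D * emeasure ?\<mu> (shell {B..2 * B})"
      by (simp add: nn_integral_add nn_integral_cmult emeasure_log_measure)
    also have "emeasure ?\<mu> (shell {B..2 * B}) = emeasure ?\<mu> (shell {1..2})"
    proof -
      have "(\<lambda>r. r / B) -` {1..2} = {B..2 * B}"
        using B by (auto simp: field_simps)
      then show ?thesis
        using emeasure_log_measure_scale[of "{1..2}" B, where 'a = 'a] B by simp
    qed
    also have "ennreal (\<kappa> powr p) * emeasure ?\<mu> (shell {2<..<B}) + ennreal D * emeasure ?\<mu> (shell {1..2})
        + ennreal D * emeasure ?\<mu> (shell {1..2}) = ennreal (\<kappa> powr p * T + D * (2 * m))"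
      using T(2) \<open>D \<ge> 0\<close> unfolding T(1) m by (simp add: ennreal_mult[symmetric] m_def flip: ennreal_plus)
    finally show ?thesis
      using T(2) \<open>D \<ge> 0\<close> by (subst (asm) ennreal_le_iff) (auto simp: m_def)
  qed
  define m1 where "m1 = measure ?\<mu> (shell {1<..<2})"
  have m1: "emeasure ?\<mu> (shell {1<..<2}) = ennreal m1"
    unfolding m1_def by (rule finite_shell[of _ 2]) auto
  have "m1 > 0"
    using emeasure_log_measure_shell_pos[where 'a = 'a] unfolding m1 by simp
  \<comment> \<open>The excess (c - \<kappa>^p) T is bounded by 2 D m according to
    \<open>main\<close>, while T is at least N \<open>m1\<close>; this N makes the two
    incompatible.\<close>
  obtain N :: nat where N: "real N > D * (2 * m) / ((c - \<kappa> powr p) * m1)"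
    using reals_Archimedean2 by blast
  \<comment> \<open>The exponent is N + 2, so that B \<ge> 4 holds even for N = 0.\<close>
  let ?B = "2 ^ (Suc N + 1) :: real"
  have B: "?B \<ge> 4" by simp
  define T where "T = measure ?\<mu> (shell {2<..<?B})"
  have T: "emeasure ?\<mu> (shell {2<..<?B}) = ennreal T"
    unfolding T_def by (rule finite_shell[of _ ?B]) auto
  have "ennreal (real (Suc N) * m1) \<le> ennreal T"
    using emeasure_log_measure_unbounded[of "Suc N", where 'a = 'a] unfolding T m1
    by (simp only: ennreal_of_nat_eq_real_of_nat ennreal_mult' of_nat_0_le_iff)
  then have "real (Suc N) * m1 \<le> T"
    by (simp add: T_def del: of_nat_Suc)
  then have "real N * m1 \<le> T" using \<open>m1 > 0\<close> by (simp add: algebra_simps)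
  then have "(c - \<kappa> powr p) * (real N * m1) \<le> (c - \<kappa> powr p) * T"
    using c by (intro mult_left_mono) auto
  also have "\<dots> \<le> D * (2 * m)"
    using main[OF B T] by (simp add: T_def algebra_simps)
  finally show False
    using N c \<open>m1 > 0\<close> by (simp add: field_simps)
qed

subsection \<open>The Hardy constant\<close>

definition bump :: "'a::euclidean_space \<Rightarrow> real \<Rightarrow> 'a \<Rightarrow> real" where
  "bump a \<epsilon> x = flat_exp 0 (\<epsilon>\<^sup>2 - (x - a) \<bullet> (x - a))"

lemma bump_nonzero_iff:
  assumes "\<epsilon> > 0"
  shows "bump a \<epsilon> x \<noteq> 0 \<longleftrightarrow> dist a x < \<epsilon>"
proof -
  have "bump a \<epsilon> x \<noteq> 0 \<longleftrightarrow> (dist a x)\<^sup>2 < \<epsilon>\<^sup>2"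
    by (simp add: bump_def flat_exp_def dist_norm norm_minus_commute[of a] power2_norm_eq_inner)
  also have "\<dots> \<longleftrightarrow> dist a x < \<epsilon>"
    using assms power_mono_iff[of \<epsilon> "dist a x" 2] by (simp add: not_le[symmetric])
  finally show ?thesis .
qed

lemma bump_test_function:
  assumes "\<epsilon> > 0" "cball a \<epsilon> \<subseteq> \<Omega>"
  shows "bump a \<epsilon> \<in> test_functions \<Omega>"
proof -
  have supp: "closure {x. bump a \<epsilon> x \<noteq> 0} = cball a \<epsilon>"
    using assms(1) by (simp add: bump_nonzero_iff closure_ball[symmetric] ball_def)
  have "smooth_fun (bump a \<epsilon>)"
    unfolding bump_def
    by (intro smooth_fun.flat_exp smooth_fun_diff smooth_fun.const smooth_fun_inner_self)
  then show ?thesis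
    using assms(2) unfolding test_functions_def mem_Collect_eq supp
    by (auto intro: smooth_fun_imp_C_infinity)
qed

text \<open>A supremum of reals can be compared with its members only if the set is bounded. One
  bump suffices: its gradient integral L is finite and its weighted integral R is nonzero, so L / R
  is a bound.\<close>

lemma bdd_above_hardy_constants:
  fixes \<Omega> :: "'a::euclidean_space set"
  assumes \<Omega>: "is_domain \<Omega>" "\<Omega> \<noteq> UNIV" and "p > 0"
  shows "bdd_above {c. c \<ge> 0 \<and> (\<forall>\<phi>\<in>test_functions \<Omega>.
        (\<integral>\<^sup>+x\<in>\<Omega>. ennreal (norm (gradient \<phi> x) powr p) \<partial>lborel)
        \<ge> ennreal c * (\<integral>\<^sup>+x\<in>\<Omega>. ennreal (\<bar>\<phi> x\<bar> powr p / bdist \<Omega> x powr p) \<partial>lborel))}"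
proof -
  have [measurable]: "\<Omega> \<in> sets borel"
    using \<Omega> by (simp add: is_domain_def)
  obtain a where "a \<in> \<Omega>" using \<Omega> by (auto simp: is_domain_def)
  then obtain \<epsilon> where \<epsilon>: "\<epsilon> > 0" "cball a \<epsilon> \<subseteq> \<Omega>"
    using \<Omega> open_contains_cball unfolding is_domain_def by blast
  let ?\<phi> = "bump a \<epsilon>"
  have \<phi>: "?\<phi> \<in> test_functions \<Omega>" by (rule bump_test_function[OF \<epsilon>])
  then have smooth: "C_infinity ?\<phi>" by (simp add: test_functions_def)
  have [measurable]: "?\<phi> \<in> borel_measurable borel"
    by (intro borel_measurable_continuous_onI continuous_at_imp_continuous_on ballI
        has_derivative_continuous[OF C_infinity_has_derivative[OF smooth]])
  have [measurable]: "bdist \<Omega> \<in> borel_measurable borel"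
    by (intro borel_measurable_continuous_onI continuous_on_bdist)
  define L where "L = (\<integral>\<^sup>+x\<in>\<Omega>. ennreal (norm (gradient ?\<phi> x) powr p) \<partial>lborel)"
  define R where "R = (\<integral>\<^sup>+x\<in>\<Omega>. ennreal (\<bar>?\<phi> x\<bar> powr p / bdist \<Omega> x powr p) \<partial>lborel)"
  have "L < top"
  proof -
    have "bounded (gradient ?\<phi> ` cball a \<epsilon>)"
      by (intro compact_imp_bounded compact_continuous_image
          continuous_on_subset[OF C_infinity_continuous_gradient[OF smooth]]) auto
    then obtain M where M: "\<forall>x\<in>cball a \<epsilon>. norm (gradient ?\<phi> x) \<le> M"
      by (auto simp: bounded_iff)
    have "gradient ?\<phi> x = 0" if "x \<notin> cball a \<epsilon>" for x
    proof (rule gradient_eq_0_outside_support)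
      have "closure {x. ?\<phi> x \<noteq> 0} \<subseteq> cball a \<epsilon>"
        using \<epsilon> by (intro closure_minimal) (auto simp: bump_nonzero_iff)
      with that show "x \<notin> closure {x. ?\<phi> x \<noteq> 0}" by blast
    qed
    then have "L \<le> (\<integral>\<^sup>+x. ennreal (M powr p) * indicator (cball a \<epsilon>) x \<partial>lborel)"
      unfolding L_def using M \<open>p > 0\<close>
      by (intro nn_integral_mono) (force simp: indicator_def intro!: ennreal_leI powr_mono2)
    also have "\<dots> = ennreal (M powr p) * emeasure lborel (cball a \<epsilon>)"
      by (rule nn_integral_cmult_indicator) simp
    also have "\<dots> < top"
      using emeasure_lborel_cball_finite[of a \<epsilon>] by (simp add: ennreal_mult_less_top)
    finally show ?thesis .
  qed
  have "R \<noteq> 0"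
  proof
    assume "R = 0"
    then have "AE x in lborel. ennreal (\<bar>?\<phi> x\<bar> powr p / bdist \<Omega> x powr p) * indicator \<Omega> x = 0"
      unfolding R_def by (subst (asm) nn_integral_0_iff_AE) auto
    then have "AE x in lborel. x \<notin> ball a \<epsilon>"
    proof eventually_elim
      case (elim x)
      show ?case
      proof
        assume "x \<in> ball a \<epsilon>"
        then have x: "x \<in> \<Omega>" "?\<phi> x \<noteq> 0" using \<epsilon> by (auto simp: bump_nonzero_iff)
        with elim bdist_pos[OF \<Omega> x(1)] show False by auto
      qed
    qed
    then show False
      using AE_avoids_open_imp_empty[of "ball a \<epsilon>"] \<epsilon>(1) by simp
  qed
  show ?thesis
  proof (rule bdd_aboveI[of _ "enn2real L / enn2real R"])
    fix c assume "c \<in> {c. c \<ge> 0 \<and> (\<forall>\<phi>\<in>test_functions \<Omega>.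
        (\<integral>\<^sup>+x\<in>\<Omega>. ennreal (norm (gradient \<phi> x) powr p) \<partial>lborel)
        \<ge> ennreal c * (\<integral>\<^sup>+x\<in>\<Omega>. ennreal (\<bar>\<phi> x\<bar> powr p / bdist \<Omega> x powr p) \<partial>lborel))}"
    then have c: "c \<ge> 0" "ennreal c * R \<le> L"
      using \<phi> by (auto simp: R_def L_def)
    obtain l where l: "L = ennreal l" "l \<ge> 0" using \<open>L < top\<close> by (cases L) auto
    show "c \<le> enn2real L / enn2real R"
    proof (cases R)
      case (real r)
      then have "r > 0" using \<open>R \<noteq> 0\<close> by (cases "r = 0") auto
      have "c * r \<le> l"
        using c l real by (simp add: ennreal_mult[symmetric])
      then show ?thesis using l real \<open>r > 0\<close> by (simp add: field_simps)
    next
      \<comment> \<open>Here \<open>enn2real R = 0\<close>, so the claimed bound reads 0; finiteness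
        of L forces c = 0.\<close>
      case top
      then have "c = 0"
        using c l by (cases "c = 0") (auto simp: ennreal_mult_top top_unique)
      then show ?thesis by simp
    qed
  qed
qed

lemma hardy_const_ge:
  fixes \<Omega> :: "'a::euclidean_space set"
  assumes \<Omega>: "is_domain \<Omega>" "\<Omega> \<noteq> UNIV" and p: "1 < p" "p > real DIM('a)"
  shows "hardy_const p \<Omega> \<ge> ((p - real DIM('a)) / p) powr p"
  unfolding hardy_const_def
proof (rule cSup_upper)
  \<comment> \<open>The case \<alpha> = 0 still carries the weight
    \<open>bdist \<Omega> x powr 0\<close>. It equals 1 because the distance is positive on
    \<Omega>, whereas \<open>0 powr 0 = 0\<close>.\<close>
  have eq: "(\<integral>\<^sup>+x\<in>\<Omega>. ennreal (norm (gradient \<phi> x) powr p / bdist \<Omega> x powr 0) \<partial>lborel)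
      = (\<integral>\<^sup>+x\<in>\<Omega>. ennreal (norm (gradient \<phi> x) powr p) \<partial>lborel)" for \<phi> :: "'a \<Rightarrow> real"
    using bdist_pos[OF \<Omega>] by (intro nn_integral_cong) (force simp: indicator_def)
  have "weighted_hardy_ineq p 0 \<Omega> (((0 + p - real DIM('a)) / p) powr p)"
    using p by (intro weighted_hardy_ineq_domain[OF \<Omega>]) auto
  then show "((p - real DIM('a)) / p) powr p \<in> {c. c \<ge> 0 \<and> (\<forall>\<phi>\<in>test_functions \<Omega>.
        (\<integral>\<^sup>+x\<in>\<Omega>. ennreal (norm (gradient \<phi> x) powr p) \<partial>lborel)
        \<ge> ennreal c * (\<integral>\<^sup>+x\<in>\<Omega>. ennreal (\<bar>\<phi> x\<bar> powr p / bdist \<Omega> x powr p) \<partial>lborel))}"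
    unfolding weighted_hardy_ineq_def eq by simp
next
  show "bdd_above {c. c \<ge> 0 \<and> (\<forall>\<phi>\<in>test_functions \<Omega>.
        (\<integral>\<^sup>+x\<in>\<Omega>. ennreal (norm (gradient \<phi> x) powr p) \<partial>lborel)
        \<ge> ennreal c * (\<integral>\<^sup>+x\<in>\<Omega>. ennreal (\<bar>\<phi> x\<bar> powr p / bdist \<Omega> x powr p) \<partial>lborel))}"
    by (rule bdd_above_hardy_constants[OF \<Omega>]) (use p in simp)
qed

theorem theorem1p1:
  fixes p \<alpha> :: real
  assumes "CARD('n::finite) \<ge> 2"
    and "1 < p"
    and "\<alpha> + p > real CARD('n)"
  shows "(\<forall>\<Omega> :: (real ^ 'n) set. is_domain \<Omega> \<and> \<Omega> \<noteq> UNIV \<longrightarrow>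
            weighted_hardy_ineq p \<alpha> \<Omega> (((\<alpha> + p - real CARD('n)) / p) powr p))
       \<and> (\<forall>c > ((\<alpha> + p - real CARD('n)) / p) powr p.
            \<not> (\<forall>\<Omega> :: (real ^ 'n) set. is_domain \<Omega> \<and> \<Omega> \<noteq> UNIV \<longrightarrow> weighted_hardy_ineq p \<alpha> \<Omega> c))
       \<and> (p > real CARD('n) \<longrightarrow>
            (\<forall>\<Omega> :: (real ^ 'n) set. is_domain \<Omega> \<and> \<Omega> \<noteq> UNIV \<longrightarrow>
               hardy_const p \<Omega> \<ge> ((p - real CARD('n)) / p) powr p))"
proof (intro conjI allI impI)
  fix c assume c: "c > ((\<alpha> + p - real CARD('n)) / p) powr p"
  show "\<not> (\<forall>\<Omega> :: (real ^ 'n) set. is_domain \<Omega> \<and> \<Omega> \<noteq> UNIV \<longrightarrow> weighted_hardy_ineq p \<alpha> \<Omega> c)"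
  proof
    assume "\<forall>\<Omega> :: (real ^ 'n) set. is_domain \<Omega> \<and> \<Omega> \<noteq> UNIV \<longrightarrow> weighted_hardy_ineq p \<alpha> \<Omega> c"
    then have "weighted_hardy_ineq p \<alpha> (- {0 :: real ^ 'n}) c"
      using is_domain_punctured[where 'a = "real ^ 'n"] assms(1) by auto
    from hardy_punctured_sharp[OF assms(2) refl _ this] c assms show False by simp
  qed
qed (use assms weighted_hardy_ineq_domain[where 'a = "real ^ 'n"] hardy_const_ge[where 'a = "real ^ 'n"] in auto)

end
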